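(* Let $A=(A_{ij})_{i,j=1}^2$ be an arbitrary bounded selfadjoint block operator in the Hilbert space $\mathfrak H=\mathfrak H_1\oplus\mathfrak H_2$ which satisfies the range inclusion $\operatorname{ran}A_{12}\subset\operatorname{ran}|A_{11}|^{1/2}$, let $J=\operatorname{sign}(A_{11})$, and let $S=|A_{11}|^{[-1/2]}A_{12}$. Then $\nu_-(A)<\infty$ if and only if $\nu_-(A_{11})<\infty$ and $\nu_-(A_{22}-S^*JS)<\infty$; in this case $$\nu_-(A)=\nu_-(A_{11})+\nu_-(A_{22}-S^*JS).$$ In particular, $A\ge0$ if and only if $\operatorname{ran}A_{12}\subset\operatorname{ran}|A_{11}|^{1/2}$, $A_{11}\ge0$, and $A_{22}-S^*JS\ge0$.
   Context: For a bounded selfadjoint operator $X$ with spectral family $E_t$: $\nu_-(X)$ is the dimension of its spectral subspace for $(-\infty,0)$; $|X|=(X^2)^{1/2}$; $\operatorname{sign}(X)=\int_{\mathbb R}\operatorname{sign}(t)\,dE_t$ with $\operatorname{sign}(t)=1$ for $t\ge0$ and $-1$ for $t<0$. $|X|^{[-1/2]}$ denotes the (generalized) Moore–Penrose inverse of $|X|^{1/2}$: it is defined on $\operatorname{ran}|X|^{1/2}\oplus\ker X$, equals the inverse of $|X|^{1/2}$ restricted to $(\ker X)^\perp$ on $\operatorname{ran}|X|^{1/2}$, and is zero on $\ker X$. Under the range inclusion $S$ is an everywhere defined bounded operator from $\mathfrak H_2$ to $\mathfrak H_1$. *)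

theory Defs
  imports "HOL-Analysis.Analysis" "HOL-Library.Extended_Nat"
begin

section \<open>Complex Hilbert spaces\<close>

text \<open>The inner product is antilinear in its first and linear in its second argument.
  The zero space is an instance.\<close>

class complex_inner = real_normed_vector +
  fixes scaleC :: "complex \<Rightarrow> 'a \<Rightarrow> 'a"  (infixr "*\<^sub>C" 75)
    and cinner :: "'a \<Rightarrow> 'a \<Rightarrow> complex"
  assumes scaleC_add_right: "c *\<^sub>C (x + y) = c *\<^sub>C x + c *\<^sub>C y"
    and scaleC_add_left: "(c + d) *\<^sub>C x = c *\<^sub>C x + d *\<^sub>C x"
    and scaleC_scaleC: "c *\<^sub>C (d *\<^sub>C x) = (c * d) *\<^sub>C x"
    and scaleR_scaleC: "scaleR r x = complex_of_real r *\<^sub>C x"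
    and cinner_commute: "cinner x y = cnj (cinner y x)"
    and cinner_add_right: "cinner x (y + z) = cinner x y + cinner x z"
    and cinner_scaleC_right: "cinner x (c *\<^sub>C y) = c * cinner x y"
    and cinner_self: "cinner x x = complex_of_real ((norm x)\<^sup>2)"

class chilbert_space = complex_inner + complete_space

global_interpretation complex_vector:
  vector_space "scaleC :: complex \<Rightarrow> 'a::complex_inner \<Rightarrow> 'a"
  defines cspan = complex_vector.span and cdim = complex_vector.dim
proof
  fix x :: 'a
  show "1 *\<^sub>C x = x"
    using scaleR_scaleC[of 1 x] by simp
qed (simp_all add: scaleC_add_right scaleC_add_left scaleC_scaleC)

text \<open>The orthogonal direct sum of two Hilbert spaces is the product type; its library norm
  is the square root of the sum of the squared norms.\<close>

instantiation prod :: (complex_inner, complex_inner) complex_inner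
begin

definition scaleC_prod :: "complex \<Rightarrow> 'a \<times> 'b \<Rightarrow> 'a \<times> 'b" where
  "scaleC_prod c p = (c *\<^sub>C fst p, c *\<^sub>C snd p)"

definition cinner_prod :: "'a \<times> 'b \<Rightarrow> 'a \<times> 'b \<Rightarrow> complex" where
  "cinner_prod p q = cinner (fst p) (fst q) + cinner (snd p) (snd q)"

instance
proof
  fix x y :: "'a \<times> 'b"
  show "cinner x y = cnj (cinner y x)"
    by (simp add: cinner_prod_def) (metis cinner_commute)
  show "cinner x x = complex_of_real ((norm x)\<^sup>2)"
    by (simp add: cinner_prod_def cinner_self norm_prod_def)
qed (simp_all add: scaleC_prod_def cinner_prod_def scaleC_add_right scaleC_add_left
      scaleC_scaleC scaleR_scaleC cinner_add_right cinner_scaleC_right prod_eq_iff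
      algebra_simps)

end

instance prod :: (chilbert_space, chilbert_space) chilbert_space ..

text \<open>Only finiteness of a dimension matters here, so all infinite dimensions are
  identified. (The library's \<open>dim\<close> is \<open>0\<close> in the infinite-dimensional case.)\<close>

definition ecdim :: "'a::complex_inner set \<Rightarrow> enat" where
  "ecdim V = (if \<exists>B. finite B \<and> V \<subseteq> cspan B then enat (cdim V) else \<infinity>)"


section \<open>Bounded operators\<close>

definition bounded_clinear :: "('a::complex_inner \<Rightarrow> 'b::complex_inner) \<Rightarrow> bool" where
  "bounded_clinear T \<longleftrightarrow> bounded_linear T \<and> (\<forall>c x. T (c *\<^sub>C x) = c *\<^sub>C T x)"

definition selfadjoint :: "('a::complex_inner \<Rightarrow> 'a) \<Rightarrow> bool" where
  "selfadjoint T \<longleftrightarrow> bounded_clinear T \<and> (\<forall>x y. cinner (T x) y = cinner x (T y))"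

definition nonneg_op :: "('a::complex_inner \<Rightarrow> 'a) \<Rightarrow> bool" where
  "nonneg_op T \<longleftrightarrow> selfadjoint T \<and> (\<forall>x. 0 \<le> Re (cinner x (T x)))"

definition orth_projection :: "('a::complex_inner \<Rightarrow> 'a) \<Rightarrow> bool" where
  "orth_projection P \<longleftrightarrow> selfadjoint P \<and> P \<circ> P = P"

definition adj :: "('a::complex_inner \<Rightarrow> 'b::complex_inner) \<Rightarrow> 'b \<Rightarrow> 'a" where
  "adj T = (THE T'. \<forall>x y. cinner (T x) y = cinner x (T' y))"

definition op_ker :: "('a \<Rightarrow> 'b::zero) \<Rightarrow> 'a set" where
  "op_ker T = {x. T x = 0}"

definition orth_compl :: "'a::complex_inner set \<Rightarrow> 'a set" where
  "orth_compl V = {x. \<forall>v\<in>V. cinner v x = 0}"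


section \<open>Spectral family and functional calculus of a bounded selfadjoint operator\<close>

text \<open>The measure \<open>d\<langle>E\<^sub>t x, x\<rangle>\<close>, i.e. the Lebesgue-Stieltjes measure giving \<open>(a, b]\<close> the mass
  \<open>\<langle>E\<^sub>b x, x\<rangle> - \<langle>E\<^sub>a x, x\<rangle>\<close>.\<close>

definition stieltjes :: "(real \<Rightarrow> 'a::complex_inner \<Rightarrow> 'a) \<Rightarrow> 'a \<Rightarrow> real measure" where
  "stieltjes E x = interval_measure (\<lambda>t. Re (cinner x (E t x)))"

text \<open>The last clause is \<open>X = \<integral> t dE\<^sub>t\<close>, read through the quadratic forms; by polarization these
  determine an operator on a complex space. The same reading is used for \<open>\<integral> f(t) dE\<^sub>t\<close> below.\<close>

definition is_spectral_family ::
    "('a::chilbert_space \<Rightarrow> 'a) \<Rightarrow> (real \<Rightarrow> 'a \<Rightarrow> 'a) \<Rightarrow> bool" where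
  "is_spectral_family X E \<longleftrightarrow>
     (\<forall>t. orth_projection (E t)) \<and>
     (\<forall>s t. s \<le> t \<longrightarrow> E t \<circ> E s = E s) \<and>
     (\<forall>t x. ((\<lambda>s. E s x) \<longlongrightarrow> E t x) (at_right t)) \<and>
     (\<exists>m M. (\<forall>t<m. E t = (\<lambda>x. 0)) \<and> (\<forall>t\<ge>M. E t = id)) \<and>
     (\<forall>x. cinner x (X x) = complex_of_real (LINT t|stieltjes E x. t))"

definition spectral_family :: "('a::chilbert_space \<Rightarrow> 'a) \<Rightarrow> real \<Rightarrow> 'a \<Rightarrow> 'a" where
  "spectral_family X = (THE E. is_spectral_family X E)"

definition spectral_integral ::
    "('a::chilbert_space \<Rightarrow> 'a) \<Rightarrow> (real \<Rightarrow> real) \<Rightarrow> 'a \<Rightarrow> 'a" where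
  "spectral_integral X f =
     (THE B. bounded_clinear B \<and>
       (\<forall>x. cinner x (B x) =
              complex_of_real (LINT t|stieltjes (spectral_family X) x. f t)))"

definition spectral_subspace :: "('a::chilbert_space \<Rightarrow> 'a) \<Rightarrow> real set \<Rightarrow> 'a set" where
  "spectral_subspace X \<Delta> = range (spectral_integral X (indicator \<Delta>))"

definition nu_minus :: "('a::chilbert_space \<Rightarrow> 'a) \<Rightarrow> enat" where
  "nu_minus X = ecdim (spectral_subspace X {..<0})"

text \<open>In contrast to the library's \<open>sgn\<close>, the value at \<open>0\<close> is \<open>1\<close>.\<close>

definition op_sign :: "('a::chilbert_space \<Rightarrow> 'a) \<Rightarrow> 'a \<Rightarrow> 'a" where
  "op_sign X = spectral_integral X (\<lambda>t. if t \<ge> 0 then 1 else -1)"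


section \<open>Square roots and the generalized inverse\<close>

definition op_sqrt :: "('a::chilbert_space \<Rightarrow> 'a) \<Rightarrow> 'a \<Rightarrow> 'a" where
  "op_sqrt T = (THE R. nonneg_op R \<and> R \<circ> R = T)"

definition op_abs :: "('a::chilbert_space \<Rightarrow> 'a) \<Rightarrow> 'a \<Rightarrow> 'a" where
  "op_abs X = op_sqrt (X \<circ> X)"

text \<open>\<open>|X|\<^sup>[\<^sup>-\<^sup>1\<^sup>/\<^sup>2\<^sup>]\<close>: a vector \<open>y = |X|\<^sup>1\<^sup>/\<^sup>2 x + z\<close> with \<open>x \<in> (ker X)\<^sup>\<bottom>\<close> and \<open>z \<in> ker X\<close> is
  mapped to \<open>x\<close>. The value is unspecified for \<open>y\<close> outside the domain
  \<open>ran |X|\<^sup>1\<^sup>/\<^sup>2 \<oplus> ker X\<close>.\<close>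

definition abs_inv_sqrt :: "('a::chilbert_space \<Rightarrow> 'a) \<Rightarrow> 'a \<Rightarrow> 'a" where
  "abs_inv_sqrt X y =
     (THE x. x \<in> orth_compl (op_ker X) \<and>
             (\<exists>z\<in>op_ker X. y = op_sqrt (op_abs X) x + z))"


section \<open>Blocks of an operator on an orthogonal sum\<close>

definition block11 :: "('a::zero \<times> 'b::zero \<Rightarrow> 'a \<times> 'b) \<Rightarrow> 'a \<Rightarrow> 'a" where
  "block11 A x = fst (A (x, 0))"

definition block12 :: "('a::zero \<times> 'b::zero \<Rightarrow> 'a \<times> 'b) \<Rightarrow> 'b \<Rightarrow> 'a" where
  "block12 A y = fst (A (0, y))"

definition block22 :: "('a::zero \<times> 'b::zero \<Rightarrow> 'a \<times> 'b) \<Rightarrow> 'b \<Rightarrow> 'b" where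
  "block22 A y = snd (A (0, y))"

end

theory Submission imports Defs begin

text \<open>Write \<open>R = |A\<^sub>1\<^sub>1|\<^sup>1\<^sup>/\<^sup>2\<close>, so that \<open>A\<^sub>1\<^sub>1 = R J R\<close> and \<open>A\<^sub>1\<^sub>2 = R S\<close>. With \<open>T = A\<^sub>2\<^sub>2 - S\<^sup>* J S\<close> and
  \<open>D (x, y) = (R x + J S y, y)\<close> the form of \<open>A\<close> is \<open>\<langle>A p, p\<rangle> = \<langle>(J \<oplus> T) D p, D p\<rangle>\<close>. Let \<open>H\<^sub>-\<close> denote the
  negative spectral subspace and \<open>P\<^sub>-\<close> its projection. Then \<open>(P\<^sub>- \<oplus> P\<^sub>-) D\<close> maps \<open>H\<^sub>-(A)\<close> injectively
  into \<open>H\<^sub>-(A\<^sub>1\<^sub>1) \<oplus> H\<^sub>-(T)\<close>. Conversely \<open>J \<oplus> T\<close> is nonnegative on the closure \<open>Z\<close> of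
  \<open>D (H\<^sub>-(A)\<^sup>\<bottom>)\<close>, and \<open>w \<mapsto> D\<^sup>* (w - P\<^sub>Z w)\<close> maps \<open>H\<^sub>-(A\<^sub>1\<^sub>1) \<oplus> H\<^sub>-(T)\<close> injectively into \<open>H\<^sub>-(A)\<close>. So
  the dimensions agree. That \<open>A \<ge> 0\<close> forces the range inclusion is Douglas' lemma.

  The spectral projection \<open>E\<^sub>t\<close> of \<open>X\<close> is the only projection \<open>P\<close> commuting with \<open>X\<close> such that
  \<open>X \<le> t\<close> on the range of \<open>P\<close> and \<open>X > t\<close> on its orthogonal complement; uniqueness reduces to that
  of the nonnegative square root, because \<open>(1 - 2 P) (X - t) = |X - t|\<close>.\<close>

section \<open>Inner product and bounded operators\<close>

text \<open>The spectral family, \<open>op_sign\<close>, \<open>op_sqrt\<close>, \<open>adj\<close>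
  and \<open>abs_inv_sqrt\<close> are definite descriptions, so each has to be shown to exist and to
  be unique. For the spectral family this amounts to a spectral theorem: its description prescribes
  only the quadratic form of X, and even the commutation of \<open>E t\<close> with X must be
  extracted from it.

  The factorisation of the form of A through D would give the formula by Sylvester's law of inertia
  if D were invertible. But R may have a kernel and a range that is not closed, so in general D is
  neither injective nor onto, and its range need not be closed. This is why two separate comparisons
  are made, and why the second one passes to a closure. Its injectivity hinges on the kernel of R:
  the convention sign(0) = 1 makes J the identity there, and S takes values orthogonal to it, so the
  first components of Z are orthogonal to that kernel.\<close>

lemma cinner_add_left: "cinner (x + y) z = cinner x z + cinner (y::'a::complex_inner) z"
  by (subst (1 2 3) cinner_commute) (simp add: cinner_add_right)

lemma cinner_scaleC_left: "cinner (c *\<^sub>C x) y = cnj c * cinner x (y::'a::complex_inner)"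
  by (subst (1 2) cinner_commute) (simp add: cinner_scaleC_right)

lemma norm_scaleC: "norm (c *\<^sub>C x) = cmod c * norm (x::'a::complex_inner)"
proof -
  have "complex_of_real ((norm (c *\<^sub>C x))\<^sup>2) = cnj c * c * complex_of_real ((norm x)\<^sup>2)"
    by (simp only: cinner_self[symmetric] cinner_scaleC_left cinner_scaleC_right mult_ac)
  also have "\<dots> = complex_of_real ((cmod c * norm x)\<^sup>2)"
    using complex_norm_square[of c] by (simp add: power_mult_distrib mult.commute)
  finally show ?thesis
    by (simp add: of_real_eq_iff power2_eq_iff_nonneg del: of_real_power of_real_mult)
qed

lemma cinner_scaleR_left [simp]: "cinner (scaleR r x) y = of_real r * cinner x (y::'a::complex_inner)"
  by (simp add: scaleR_scaleC cinner_scaleC_left)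

lemma cinner_scaleR_right [simp]: "cinner x (scaleR r y) = of_real r * cinner x (y::'a::complex_inner)"
  by (simp add: scaleR_scaleC cinner_scaleC_right)

lemma cinner_zero [simp]: "cinner 0 x = 0" "cinner x (0::'a::complex_inner) = 0"
  using cinner_scaleR_left[of 0 x x] cinner_scaleR_right[of x 0 x] by simp_all

lemma cinner_minus [simp]:
  "cinner (- x) y = - cinner x y" "cinner x (- y) = - cinner x (y::'a::complex_inner)"
  using cinner_scaleR_left[of "-1" x y] cinner_scaleR_right[of x "-1" y] by simp_all

lemma cinner_diff_left: "cinner (x - y) z = cinner x z - cinner (y::'a::complex_inner) z"
  using cinner_add_left[of x "- y" z] by simp

lemma cinner_diff_right: "cinner x (y - z) = cinner x y - cinner x (z::'a::complex_inner)"
  using cinner_add_right[of x y "- z"] by simp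

lemmas cinner_simps = cinner_add_left cinner_add_right cinner_diff_left cinner_diff_right
  cinner_scaleC_left cinner_scaleC_right

lemma Re_cinner_commute: "Re (cinner x y) = Re (cinner y (x::'a::complex_inner))"
  by (subst cinner_commute) simp

lemma Re_cinner_self [simp]: "Re (cinner x x) = (norm (x::'a::complex_inner))\<^sup>2"
  by (simp add: cinner_self)

lemma cinner_self_eq_0 [simp]: "cinner x x = 0 \<longleftrightarrow> (x::'a::complex_inner) = 0"
  by (simp add: cinner_self)

lemma scaleC_zero [simp]: "c *\<^sub>C 0 = (0::'a::complex_inner)" "0 *\<^sub>C x = (0::'a::complex_inner)"
  using norm_scaleC[of c "0::'a"] norm_scaleC[of 0 x] by simp_all

lemma cinner_eqI:
  assumes "\<And>z. cinner z x = cinner z (y::'a::complex_inner)"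
  shows "x = y"
proof -
  have "cinner (x - y) (x - y) = 0"
    using assms by (simp add: cinner_diff_right)
  then show ?thesis by simp
qed

lemma norm_add_sq:
  "(norm (x + y))\<^sup>2 = (norm x)\<^sup>2 + 2 * Re (cinner x y) + (norm (y::'a::complex_inner))\<^sup>2"
  using Re_cinner_commute[of y x] by (simp add: cinner_simps flip: Re_cinner_self)

lemma norm_diff_sq:
  "(norm (x - y))\<^sup>2 = (norm x)\<^sup>2 - 2 * Re (cinner x y) + (norm (y::'a::complex_inner))\<^sup>2"
  using norm_add_sq[of x "- y"] by simp

text \<open>Source of the Cauchy-Schwarz bounds and of the variational argument below. The
  degenerate case d = 0 does occur there and yields b = 0.\<close>

lemma discriminant_le:
  assumes "\<And>t::real. 0 \<le> a + 2 * t * b + t\<^sup>2 * d"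
  shows "b\<^sup>2 \<le> a * d"
proof (cases "d = 0")
  case True
  have "b = 0"
  proof (rule ccontr)
    assume "b \<noteq> 0"
    \<comment> \<open>At t = -(a + 1) / (2 b) the affine function a + 2 t b equals -1.\<close>
    then show False
      using assms[of "- (a + 1) / (2 * b)"] True by (simp add: field_simps)
  qed
  with True show ?thesis by simp
next
  case False
  have "0 \<le> d"
  proof (rule ccontr)
    assume "\<not> 0 \<le> d"
    \<comment> \<open>The quotient brings t d below -(|a| + 2 |b| + 1); the summand 1 secures t
      \<ge> 1, so that |a| is dominated by t |a|.\<close>
    define t where "t = (\<bar>a\<bar> + 2 * \<bar>b\<bar> + 1) / \<bar>d\<bar> + 1"
    have t: "1 \<le> t" "t * d \<le> - (\<bar>a\<bar> + 2 * \<bar>b\<bar> + 1)"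
      using \<open>\<not> 0 \<le> d\<close> by (auto simp: t_def field_simps abs_if)
    have "a + 2 * t * b + t\<^sup>2 * d \<le> t * (\<bar>a\<bar> + 2 * \<bar>b\<bar> + t * d)"
    proof -
      have "a \<le> t * \<bar>a\<bar>"
        using mult_right_mono[OF t(1), of "\<bar>a\<bar>"] by simp
      moreover have "2 * t * b \<le> t * (2 * \<bar>b\<bar>)"
        using t(1) by (simp add: mult_left_mono)
      ultimately show ?thesis
        by (simp add: algebra_simps power2_eq_square)
    qed
    also have "\<dots> \<le> t * (- 1)"
      using t by (intro mult_left_mono) auto
    finally show False
      using assms[of t] t by simp
  qed
  with False have "0 < d" by simp
  then show ?thesis
    using assms[of "- b / d"] by (simp add: field_simps power2_eq_square)
qed

lemma obtain_phase:
  obtains c :: complex where "cmod c = 1" "c * z = of_real (cmod z)"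
proof (cases "z = 0")
  case True
  then show ?thesis using that[of 1] by simp
next
  case False
  have "cmod (cnj z / of_real (cmod z)) = 1"
    using False by (simp add: norm_divide)
  moreover have "cnj z / of_real (cmod z) * z = of_real (cmod z)"
    using False complex_norm_square[of z] by (simp add: field_simps power2_eq_square)
  ultimately show ?thesis using that by blast
qed

section \<open>Bounded operators and the Cauchy-Schwarz inequality\<close>

lemma bounded_clinear_compose:
  "bounded_clinear f \<Longrightarrow> bounded_clinear g \<Longrightarrow> bounded_clinear (\<lambda>x. f (g x))"
  by (simp add: bounded_clinear_def bounded_linear_compose)

lemma bounded_clinear_simps:
  assumes "bounded_clinear f"
  shows "f (x + y) = f x + f y" "f (x - y) = f x - f y" "f (- x) = - f x" "f 0 = 0"
    "f (c *\<^sub>C x) = c *\<^sub>C f x" "f (scaleR r x) = scaleR r (f x)"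
  using assms unfolding bounded_clinear_def
  by (auto simp: linear_simps)

lemma bounded_clinear_bound:
  assumes "bounded_clinear f"
  obtains K where "0 < K" "\<And>x. norm (f x) \<le> K * norm x"
  using assms bounded_linear.pos_bounded[of f]
  by (auto simp: bounded_clinear_def mult.commute)

lemma bounded_clinear_tendsto:
  "bounded_clinear f \<Longrightarrow> (g \<longlongrightarrow> a) F \<Longrightarrow> ((\<lambda>x. f (g x)) \<longlongrightarrow> f a) F"
  by (simp add: bounded_clinear_def bounded_linear.tendsto)

lemma bounded_clinearI:
  assumes "\<And>x y. f (x + y) = f x + f y" "\<And>c x. f (c *\<^sub>C x) = c *\<^sub>C f x"
    "\<And>x. norm (f x) \<le> K * norm x"
  shows "bounded_clinear f"
  unfolding bounded_clinear_def using assms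
  by (auto intro!: bounded_linear_intro[where K=K] simp: scaleR_scaleC mult.commute)

lemma bounded_clinear_id [simp]: "bounded_clinear (\<lambda>x. x)"
  by (auto intro!: bounded_clinearI[where K=1])

lemma bounded_clinear_zero [simp]: "bounded_clinear (\<lambda>x. 0)"
  by (auto intro!: bounded_clinearI[where K=1])

lemma scaleC_minus_right: "c *\<^sub>C (- x) = - (c *\<^sub>C (x::'a::complex_inner))"
  using scaleC_add_right[of c x "- x"] by (simp add: eq_neg_iff_add_eq_0 add.commute)

lemma scaleC_diff_right: "c *\<^sub>C (x - y) = c *\<^sub>C x - c *\<^sub>C (y::'a::complex_inner)"
  using scaleC_add_right[of c x "- y"] by (simp add: scaleC_minus_right)

lemma scaleC_scaleR_commute: "c *\<^sub>C (scaleR r x) = scaleR r (c *\<^sub>C (x::'a::complex_inner))"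
  by (simp add: scaleR_scaleC scaleC_scaleC mult.commute)

lemma bounded_clinear_add:
  "bounded_clinear f \<Longrightarrow> bounded_clinear g \<Longrightarrow> bounded_clinear (\<lambda>x. f x + g x)"
  by (simp add: bounded_clinear_def bounded_linear_add scaleC_add_right)

lemma bounded_clinear_diff:
  "bounded_clinear f \<Longrightarrow> bounded_clinear g \<Longrightarrow> bounded_clinear (\<lambda>x. f x - g x)"
  by (simp add: bounded_clinear_def bounded_linear_sub scaleC_diff_right)

lemma bounded_clinear_scaleR:
  "bounded_clinear f \<Longrightarrow> bounded_clinear (\<lambda>x. scaleR r (f x))"
  by (simp add: bounded_clinear_def bounded_linear_const_scaleR scaleC_scaleR_commute)

text \<open>Stated for the semi-inner product given by T: the identity yields the usual inequality,
  and the pair T x, x bounds T x by the form at x.\<close>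

lemma form_Cauchy_Schwarz:
  assumes T: "bounded_clinear T" and sym: "\<And>x y. cinner (T x) y = cinner x (T y)"
    and nn: "\<And>x. 0 \<le> Re (cinner x (T x))"
  shows "(cmod (cinner x (T y)))\<^sup>2 \<le> Re (cinner x (T x)) * Re (cinner y (T y))"
proof -
  \<comment> \<open>The phase turns the cross term into its modulus, so real multiples of c y
    suffice to bound a complex number.\<close>
  obtain c where c: "cmod c = 1" "c * cinner x (T y) = of_real (cmod (cinner x (T y)))"
    using obtain_phase .
  have cc: "cnj c * c = 1"
    using complex_norm_square[of c] c(1) by (simp add: mult.commute)
  show ?thesis
  proof (rule discriminant_le)
    fix t :: real
    define b where "b = cinner x (T y)"
    have yx: "cinner y (T x) = cnj b"
      by (metis b_def cinner_commute sym)
    have "cinner (x + (of_real t * c) *\<^sub>C y) (T (x + (of_real t * c) *\<^sub>C y))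
        = cinner x (T x) + of_real t * (c * b) + of_real t * cnj (c * b)
          + of_real (t\<^sup>2) * (cnj c * c) * cinner y (T y)"
      by (simp add: bounded_clinear_simps[OF T] cinner_simps yx algebra_simps power2_eq_square
          flip: b_def)
    also have "\<dots> = cinner x (T x) + of_real (2 * t * cmod b) + of_real (t\<^sup>2) * cinner y (T y)"
      unfolding cc using c(2) by (simp add: b_def)
    finally show "0 \<le> Re (cinner x (T x)) + 2 * t * cmod (cinner x (T y))
        + t\<^sup>2 * Re (cinner y (T y))"
      using nn[of "x + (of_real t * c) *\<^sub>C y"] by (simp add: b_def del: of_real_power)
  qed
qed

lemma Cauchy_Schwarz: "cmod (cinner x y) \<le> norm x * norm (y::'a::complex_inner)"
proof -
  have "(cmod (cinner x y))\<^sup>2 \<le> (norm x * norm y)\<^sup>2"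
    using form_Cauchy_Schwarz[of "\<lambda>x. x" x y] by (simp add: power_mult_distrib)
  then show ?thesis
    by (rule power2_le_imp_le) simp
qed

lemma bounded_bilinear_cinner: "bounded_bilinear (cinner :: 'a::complex_inner \<Rightarrow> 'a \<Rightarrow> complex)"
proof
  show "\<exists>K. \<forall>(a::'a) b. norm (cinner a b) \<le> norm a * norm b * K"
    by (intro exI[of _ 1]) (simp add: Cauchy_Schwarz)
qed (simp_all add: cinner_simps scaleR_conv_of_real)

lemmas tendsto_cinner = bounded_bilinear.tendsto[OF bounded_bilinear_cinner]

text \<open>For the difference of A and B, the forms at x + y and x + i y isolate the sum and the
  difference of the two cross terms, so both vanish. This gives uniqueness in
  \<open>spectral_integral\<close>.\<close>

lemma polarization_eq:
  assumes A: "bounded_clinear A" and B: "bounded_clinear B"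
    and eq: "\<And>x. cinner x (A x) = cinner x (B x)"
  shows "A = B"
proof
  fix y
  show "A y = B y"
  proof (rule cinner_eqI)
    fix x
    define D where "D = (\<lambda>x. A x - B x)"
    have D: "bounded_clinear D"
      unfolding D_def by (intro bounded_clinear_diff A B)
    have z: "cinner x (D x) = 0" for x
      using eq by (simp add: D_def cinner_diff_right)
    have "cinner (x + y) (D (x + y)) = cinner x (D y) + cinner y (D x)"
      by (simp add: bounded_clinear_simps[OF D] cinner_simps z)
    moreover have "cinner (x + \<i> *\<^sub>C y) (D (x + \<i> *\<^sub>C y)) = \<i> * (cinner x (D y) - cinner y (D x))"
      by (simp add: bounded_clinear_simps[OF D] cinner_simps z algebra_simps)
    ultimately have "cinner x (D y) = 0"
      by (simp add: z)
    then show "cinner x (A y) = cinner x (B y)"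
      by (simp add: D_def cinner_diff_right)
  qed
qed

section \<open>Selfadjoint and nonnegative operators\<close>

lemma selfadjoint_bounded: "selfadjoint T \<Longrightarrow> bounded_clinear T"
  by (simp add: selfadjoint_def)

lemma selfadjoint_sym: "selfadjoint T \<Longrightarrow> cinner (T x) y = cinner x (T y)"
  by (simp add: selfadjoint_def)

lemma selfadjoint_cinner_real: "selfadjoint T \<Longrightarrow> cinner x (T x) = of_real (Re (cinner x (T x)))"
  by (metis Reals_cnj_iff cinner_commute complex_is_Real_iff of_real_Re selfadjoint_sym)

lemma selfadjoint_id [simp]: "selfadjoint (\<lambda>x. x)"
  by (simp add: selfadjoint_def)

lemma selfadjoint_zero [simp]: "selfadjoint (\<lambda>x. 0)"
  by (simp add: selfadjoint_def)

lemma selfadjoint_add: "selfadjoint f \<Longrightarrow> selfadjoint g \<Longrightarrow> selfadjoint (\<lambda>x. f x + g x)"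
  by (simp add: selfadjoint_def bounded_clinear_add cinner_simps)

lemma selfadjoint_diff: "selfadjoint f \<Longrightarrow> selfadjoint g \<Longrightarrow> selfadjoint (\<lambda>x. f x - g x)"
  by (simp add: selfadjoint_def bounded_clinear_diff cinner_simps)

lemma selfadjoint_scaleR: "selfadjoint f \<Longrightarrow> selfadjoint (\<lambda>x. scaleR r (f x))"
  by (simp add: selfadjoint_def bounded_clinear_scaleR)

lemma selfadjoint_compose:
  "selfadjoint f \<Longrightarrow> selfadjoint g \<Longrightarrow> (\<And>x. f (g x) = g (f x)) \<Longrightarrow> selfadjoint (\<lambda>x. f (g x))"
  by (simp add: selfadjoint_def bounded_clinear_compose)

lemma nonneg_opD: "nonneg_op T \<Longrightarrow> selfadjoint T" "nonneg_op T \<Longrightarrow> 0 \<le> Re (cinner x (T x))"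
  by (simp_all add: nonneg_op_def)

text \<open>The form inequality for T x and x reads |T x|^4 \<le> <T x, T T x> <x, T x>, and the
  last factor is 0.\<close>

lemma nonneg_op_eq_0:
  assumes "nonneg_op T" "Re (cinner x (T x)) \<le> 0"
  shows "T x = 0"
proof -
  have "(cmod (cinner (T x) (T x)))\<^sup>2 \<le> Re (cinner (T x) (T (T x))) * Re (cinner x (T x))"
    using assms(1) by (intro form_Cauchy_Schwarz) (auto simp: nonneg_op_def selfadjoint_def)
  also have "Re (cinner x (T x)) = 0"
    using assms nonneg_opD(2)[OF assms(1)] by (simp add: order_antisym)
  finally show ?thesis
    by simp
qed

lemma selfadjoint_square_nonneg:
  assumes "selfadjoint T" shows "nonneg_op (\<lambda>x. T (T x))"
proof -
  have "cinner x (T (T x)) = of_real ((norm (T x))\<^sup>2)" for x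
    using selfadjoint_sym[OF assms, of x "T x"] by (simp add: cinner_self)
  then show ?thesis
    using assms by (simp add: nonneg_op_def selfadjoint_compose)
qed

section \<open>Riesz representation, projections and adjoints\<close>

lemma subspace_simps:
  assumes "complex_vector.subspace V"
  shows "0 \<in> V" "x \<in> V \<Longrightarrow> y \<in> V \<Longrightarrow> x + y \<in> V" "x \<in> V \<Longrightarrow> y \<in> V \<Longrightarrow> x - y \<in> V"
    "x \<in> V \<Longrightarrow> c *\<^sub>C x \<in> V" "x \<in> V \<Longrightarrow> r *\<^sub>R x \<in> V"
  using assms
  by (auto simp: complex_vector.subspace_0 complex_vector.subspace_add
      complex_vector.subspace_diff complex_vector.subspace_scale scaleR_scaleC)

text \<open>The representing vector minimises Q x = |x|^2 - 2 Re (f x), which is |z - x|^2 up to a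
  constant. The minimising sequence stays in V, its limit only in the closure. This form covers
  projections, adjoints and Douglas' lemma, where V is the range of a root.\<close>

lemma Riesz_on_subspace:
  fixes f :: "'a::chilbert_space \<Rightarrow> complex"
  assumes V: "complex_vector.subspace V"
    and add: "\<And>x y. x \<in> V \<Longrightarrow> y \<in> V \<Longrightarrow> f (x + y) = f x + f y"
    and scale: "\<And>c x. x \<in> V \<Longrightarrow> f (c *\<^sub>C x) = c * f x"
    and bound: "\<And>x. x \<in> V \<Longrightarrow> cmod (f x) \<le> C * norm x"
  obtains z where "z \<in> closure V" "\<And>x. x \<in> V \<Longrightarrow> f x = cinner z x"
proof -
  note V' = subspace_simps[OF V]
  define Q where "Q = (\<lambda>x. (norm x)\<^sup>2 - 2 * Re (f x))"
  have scaleR: "f (r *\<^sub>R x) = of_real r * f x" if "x \<in> V" for r x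
    using scale[OF that] by (simp add: scaleR_scaleC)
  have lower: "- C\<^sup>2 \<le> Q x" if "x \<in> V" for x
  proof -
    have "Re (f x) \<le> C * norm x"
      using bound[OF that] complex_Re_le_cmod order_trans by blast
    then show ?thesis
      using sum_squares_bound[of C "norm x"] by (simp add: Q_def)
  qed
  define m where "m = Inf (Q ` V)"
  have bdd: "bdd_below (Q ` V)"
    using lower by (auto intro!: bdd_belowI[of _ "- C\<^sup>2"])
  have m_le: "m \<le> Q x" if "x \<in> V" for x
    unfolding m_def using bdd that by (intro cInf_lower) auto
  have "\<exists>x\<in>V. Q x < m + 1 / real (Suc n)" for n
  proof -
    have "\<exists>q\<in>Q ` V. q < m + 1 / real (Suc n)"
      using V'(1) bdd by (subst cInf_less_iff[symmetric]) (auto simp: m_def)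
    then show ?thesis by blast
  qed
  then obtain u where u: "\<And>n. u n \<in> V" "\<And>n. Q (u n) < m + 1 / real (Suc n)"
    by metis
  \<comment> \<open>Parallelogram law at the midpoint: nearly minimal points are close to each
    other, which makes the minimising sequence Cauchy.\<close>
  have gap: "(norm (x - y))\<^sup>2 \<le> 2 * (Q x - m) + 2 * (Q y - m)" if "x \<in> V" "y \<in> V" for x y
  proof -
    have "Q ((1/2) *\<^sub>R (x + y)) = (norm (x + y))\<^sup>2 / 4 - Re (f x) - Re (f y)"
      using that V' by (simp add: Q_def scaleR add power_divide add_divide_distrib)
    moreover have "m \<le> Q ((1/2) *\<^sub>R (x + y))"
      using that V' by (intro m_le) auto
    ultimately have "m \<le> (norm (x + y))\<^sup>2 / 4 - Re (f x) - Re (f y)"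
      by simp
    then show ?thesis
      unfolding Q_def using norm_add_sq[of x y] norm_diff_sq[of x y] by argo
  qed
  have "Cauchy u"
  proof (rule metric_CauchyI)
    fix e :: real assume e: "0 < e"
    obtain N where N: "4 / e\<^sup>2 < real N"
      using reals_Archimedean2 by blast
    show "\<exists>M. \<forall>i\<ge>M. \<forall>j\<ge>M. dist (u i) (u j) < e"
    proof (intro exI allI impI)
      fix i j assume ij: "N \<le> i" "N \<le> j"
      have small: "Q (u k) - m < e\<^sup>2 / 4" if "N \<le> k" for k
      proof -
        have "4 / e\<^sup>2 < real (Suc k)"
          using N that by simp
        then have "1 / real (Suc k) < e\<^sup>2 / 4"
          using e by (simp add: field_simps)
        then show ?thesis using u(2)[of k] by linarith
      qed
      have "(norm (u i - u j))\<^sup>2 < e\<^sup>2"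
        using gap[OF u(1) u(1), of i j] small[OF ij(1)] small[OF ij(2)] by simp
      then show "dist (u i) (u j) < e"
        using e by (simp add: dist_norm power_less_imp_less_base)
    qed
  qed
  then obtain z where z: "u \<longlonglongrightarrow> z"
    using Cauchy_convergent convergent_def by blast
  have "z \<in> closure V"
    using z u(1) closure_sequential by blast
  \<comment> \<open>First variation: when \<open>u n\<close> is perturbed by t v, the deficit 1 /
    Suc n disappears in the limit, and a nonnegative quadratic in t with constant term 0 has no
    linear term.\<close>
  have Re_eq: "Re (f v) = Re (cinner z v)" if v: "v \<in> V" for v
  proof -
    have "(Re (cinner z v) - Re (f v))\<^sup>2 \<le> 0 * (norm v)\<^sup>2"
    proof (rule discriminant_le)
      fix t :: real
      have "0 \<le> 1 / real (Suc n) + 2 * t * (Re (cinner (u n) v) - Re (f v)) + t\<^sup>2 * (norm v)\<^sup>2" for n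
      proof -
        have "m \<le> Q (u n + t *\<^sub>R v)"
          using V' u(1) v by (intro m_le) auto
        also have "\<dots> = Q (u n) + 2 * t * (Re (cinner (u n) v) - Re (f v)) + t\<^sup>2 * (norm v)\<^sup>2"
          using V' u(1) v
          by (simp add: Q_def norm_add_sq add scaleR power_mult_distrib algebra_simps)
        finally show ?thesis using u(2)[of n] by simp
      qed
      moreover have "(\<lambda>n. 1 / real (Suc n) + 2 * t * (Re (cinner (u n) v) - Re (f v)) + t\<^sup>2 * (norm v)\<^sup>2)
          \<longlonglongrightarrow> 0 + 2 * t * (Re (cinner z v) - Re (f v)) + t\<^sup>2 * (norm v)\<^sup>2"
        by (intro tendsto_intros tendsto_cinner z LIMSEQ_Suc[OF lim_1_over_n])
      ultimately show "0 \<le> 0 + 2 * t * (Re (cinner z v) - Re (f v)) + t\<^sup>2 * (norm v)\<^sup>2"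
        by (intro LIMSEQ_le_const[where a = 0]) auto
    qed
    then show ?thesis by simp
  qed
  have "f v = cinner z v" if v: "v \<in> V" for v
  proof (rule complex_eqI)
    show "Re (f v) = Re (cinner z v)"
      by (rule Re_eq[OF v])
    \<comment> \<open>The real part at i v is minus the imaginary part at v.\<close>
    show "Im (f v) = Im (cinner z v)"
      using Re_eq[of "\<i> *\<^sub>C v"] v V' by (simp add: scale cinner_scaleC_right)
  qed
  with \<open>z \<in> closure V\<close> show thesis
    by (rule that)
qed

section \<open>Orthogonal projections and adjoints\<close>

lemma orth_projection_sym: "orth_projection P \<Longrightarrow> cinner (P x) y = cinner x (P y)"
  by (simp add: orth_projection_def selfadjoint_sym)

lemma orth_projection_bounded: "orth_projection P \<Longrightarrow> bounded_clinear P"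
  by (simp add: orth_projection_def selfadjoint_def)

lemma orth_projection_idem: "orth_projection P \<Longrightarrow> P (P x) = P x"
  by (metis comp_apply orth_projection_def)

lemma orth_projectionI: "selfadjoint P \<Longrightarrow> (\<And>x. P (P x) = P x) \<Longrightarrow> orth_projection P"
  by (auto simp: orth_projection_def)

lemma cinner_orth_projection: "orth_projection P \<Longrightarrow> cinner x (P x) = of_real ((norm (P x))\<^sup>2)"
  by (metis cinner_self orth_projection_idem orth_projection_sym)

lemma orth_projection_compl: "orth_projection P \<Longrightarrow> orth_projection (\<lambda>x. x - P x)"
  by (rule orth_projectionI)
    (simp_all add: selfadjoint_diff orth_projection_idem
      bounded_clinear_simps(2)[OF orth_projection_bounded] orth_projection_def[THEN iffD1])

lemma norm_orth_projection_split:
  assumes "orth_projection P"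
  shows "(norm x)\<^sup>2 = (norm (P x))\<^sup>2 + (norm (x - P x))\<^sup>2"
  using norm_diff_sq[of x "P x"] cinner_orth_projection[OF assms, of x] by simp

lemma norm_orth_projection_le: "orth_projection P \<Longrightarrow> norm (P x) \<le> norm x"
  using norm_orth_projection_split[of P x] by (intro power2_le_imp_le[OF _ norm_ge_zero]) simp

text \<open>P w is the Riesz vector of \<open>cinner w\<close> restricted to V, and closedness keeps
  it in V. Linearity of P comes from the uniqueness of that vector.\<close>

lemma orth_projection_onto:
  fixes V :: "'a::chilbert_space set"
  assumes V: "complex_vector.subspace V" and "closed V"
  obtains P where "orth_projection P" "range P = V"
proof -
  note V' = subspace_simps[OF V]
  have "\<exists>z\<in>V. \<forall>x\<in>V. cinner w x = cinner z x" for w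
  proof -
    obtain z where "z \<in> closure V" "\<And>x. x \<in> V \<Longrightarrow> cinner w x = cinner z x"
      by (rule Riesz_on_subspace[of V "cinner w" "norm w"])
        (use V in \<open>auto simp: cinner_simps Cauchy_Schwarz\<close>)
    then show ?thesis using \<open>closed V\<close> by auto
  qed
  then obtain P where P: "\<And>w. P w \<in> V" "\<And>w x. x \<in> V \<Longrightarrow> cinner w x = cinner (P w) x"
    by metis
  have uniq: "P w = z" if "z \<in> V" "\<And>x. x \<in> V \<Longrightarrow> cinner w x = cinner z x" for w z
  proof -
    have "P w - z \<in> V"
      using V'(3)[OF P(1) that(1)] .
    then have "cinner (P w) (P w - z) = cinner z (P w - z)"
      using that(2) P(2) by metis
    then have "cinner (P w - z) (P w - z) = 0"
      by (simp only: cinner_diff_left diff_self)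
    then show ?thesis by simp
  qed
  have idem: "P x = x" if "x \<in> V" for x
    using uniq[of x x] that by blast
  have "selfadjoint P"
    unfolding selfadjoint_def
  proof (intro conjI allI bounded_clinearI[where K=1])
    show "P (x + y) = P x + P y" for x y
      by (rule uniq) (simp_all add: V' P(1) cinner_add_left flip: P(2))
    show "P (c *\<^sub>C x) = c *\<^sub>C P x" for c x
      by (rule uniq) (simp_all add: V' P(1) cinner_scaleC_left flip: P(2))
    have "norm (P x) * norm (P x) \<le> norm x * norm (P x)" for x
    proof -
      have "norm (P x) * norm (P x) = cmod (cinner x (P x))"
        using P(2)[OF P(1), of x x] by (simp add: cinner_self norm_power power2_eq_square norm_mult)
      then show ?thesis using Cauchy_Schwarz by metis
    qed
    then show "norm (P x) \<le> 1 * norm x" for x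
      using mult_right_le_imp_le[of "norm (P x)" "norm (P x)" "norm x"] by (cases "P x = 0") auto
    show "cinner (P x) y = cinner x (P y)" for x y
    proof -
      have "cinner x (P y) = cinner (P x) (P y)"
        using P by blast
      also have "\<dots> = cnj (cinner (P y) (P x))"
        by (rule cinner_commute)
      also have "cinner (P y) (P x) = cinner y (P x)"
        using P by metis
      finally show ?thesis
        using cinner_commute[of "P x" y] by simp
    qed
  qed
  then have "orth_projection P"
    using idem P(1) by (intro orth_projectionI) auto
  moreover have "range P = V"
    using P(1) idem by (metis image_subset_iff rangeI subsetI subset_antisym)
  ultimately show thesis by (rule that)
qed

lemma adj_exists:
  fixes T :: "'a::chilbert_space \<Rightarrow> 'b::complex_inner"
  assumes T: "bounded_clinear T"
  shows "\<exists>!T'. \<forall>x y. cinner (T x) y = cinner x (T' y)"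
proof (rule ex_ex1I)
  have "\<exists>z. \<forall>x. cinner (T x) y = cinner x z" for y
  proof -
    obtain K where K: "0 < K" "\<And>x. norm (T x) \<le> K * norm x"
      using bounded_clinear_bound[OF T] by blast
    have bound: "cmod (cinner y (T x)) \<le> (norm y * K) * norm x" for x
      using order_trans[OF Cauchy_Schwarz mult_left_mono[OF K(2) norm_ge_zero[of y]]]
      by (simp add: mult.assoc)
    obtain z where "\<And>x. x \<in> UNIV \<Longrightarrow> cinner y (T x) = cinner z x"
      by (rule Riesz_on_subspace[of UNIV "\<lambda>x. cinner y (T x)" "norm y * K"])
        (simp_all add: bound bounded_clinear_simps[OF T] cinner_simps)
    then have "cinner (T x) y = cinner x z" for x
      using cinner_commute[of "T x" y] cinner_commute[of x z] by simp
    then show ?thesis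
      by blast
  qed
  then show "\<exists>T'. \<forall>x y. cinner (T x) y = cinner x (T' y)"
    by metis
next
  fix A B assume "\<forall>x y. cinner (T x) y = cinner x (A y)" "\<forall>x y. cinner (T x) y = cinner x (B y)"
  then show "A = B"
    by (intro ext cinner_eqI) simp
qed

lemma cinner_adj:
  fixes T :: "'a::chilbert_space \<Rightarrow> 'b::complex_inner"
  shows "bounded_clinear T \<Longrightarrow> cinner (T x) y = cinner x (adj T y)"
  unfolding adj_def by (drule adj_exists, drule theI') blast

lemma cinner_adj':
  fixes T :: "'a::chilbert_space \<Rightarrow> 'b::complex_inner"
  shows "bounded_clinear T \<Longrightarrow> cinner (adj T y) x = cinner y (T x)"
  by (metis cinner_adj cinner_commute)

lemma bounded_clinear_adj:
  fixes T :: "'a::chilbert_space \<Rightarrow> 'b::complex_inner"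
  assumes T: "bounded_clinear T"
  shows "bounded_clinear (adj T)"
proof -
  obtain K where K: "0 < K" "\<And>x. norm (T x) \<le> K * norm x"
    using bounded_clinear_bound[OF T] by blast
  show ?thesis
  proof (rule bounded_clinearI)
    show "adj T (x + y) = adj T x + adj T y" for x y
      by (rule cinner_eqI) (simp add: cinner_simps flip: cinner_adj[OF T])
    show "adj T (c *\<^sub>C x) = c *\<^sub>C adj T x" for c x
      by (rule cinner_eqI) (simp add: cinner_simps flip: cinner_adj[OF T])
    show "norm (adj T y) \<le> K * norm y" for y
    proof -
      have "norm (adj T y) * norm (adj T y) = cmod (cinner (T (adj T y)) y)"
        by (simp add: cinner_adj[OF T] cinner_self norm_power power2_eq_square norm_mult)
      also have "\<dots> \<le> norm (T (adj T y)) * norm y"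
        by (rule Cauchy_Schwarz)
      also have "\<dots> \<le> (K * norm (adj T y)) * norm y"
        using K by (intro mult_right_mono) auto
      finally show ?thesis
        using K by (cases "adj T y = 0") (auto simp: mult_ac)
    qed
  qed
qed

section \<open>Square roots of nonnegative operators\<close>

text \<open>The form inequality for B x and x gives |B x|^4 \<le> |B x|^2 |x|^2. Thus the order
  bound 0 \<le> B \<le> 1 becomes the norm bound required by the iteration for square roots.\<close>

lemma nonneg_op_contraction:
  assumes B: "nonneg_op B" and le: "\<And>x. Re (cinner x (B x)) \<le> (norm x)\<^sup>2"
  shows "norm (B x) \<le> norm x"
proof -
  have "(norm (B x))\<^sup>2 * (norm (B x))\<^sup>2 = (cmod (cinner (B x) (B x)))\<^sup>2"
    by (simp add: cinner_self norm_power norm_mult power2_eq_square)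
  also have "\<dots> \<le> Re (cinner (B x) (B (B x))) * Re (cinner x (B x))"
    using B by (intro form_Cauchy_Schwarz) (auto simp: nonneg_op_def selfadjoint_def)
  also have "\<dots> \<le> (norm (B x))\<^sup>2 * (norm x)\<^sup>2"
    using le nonneg_opD(2)[OF B] by (intro mult_mono) auto
  finally have *: "(norm (B x))\<^sup>2 * (norm (B x))\<^sup>2 \<le> (norm (B x))\<^sup>2 * (norm x)\<^sup>2" .
  have "(norm (B x))\<^sup>2 \<le> (norm x)\<^sup>2"
  proof (cases "B x = 0")
    case False
    then show ?thesis by (intro mult_left_le_imp_le[OF *]) simp
  qed simp
  then show ?thesis
    by (rule power2_le_imp_le) simp
qed

text \<open>A fixed point Y of Y = (B + Y^2) / 2 satisfies (1 - Y)^2 = 1 - B, so the iteration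
  produces a root of 1 - B.\<close>

primrec sqrt_iter :: "('a::complex_inner \<Rightarrow> 'a) \<Rightarrow> nat \<Rightarrow> 'a \<Rightarrow> 'a" where
  "sqrt_iter B 0 = (\<lambda>x. 0)"
| "sqrt_iter B (Suc n) = (\<lambda>x. (1/2) *\<^sub>R (B x + sqrt_iter B n (sqrt_iter B n x)))"

text \<open>The same iteration for the scalar B = 1. Its increments dominate those of the operator
  iteration, so a bounded monotone sequence of reals controls convergence.\<close>

primrec sqrt_majorant :: "nat \<Rightarrow> real" where
  "sqrt_majorant 0 = 0"
| "sqrt_majorant (Suc n) = (1 + (sqrt_majorant n)\<^sup>2) / 2"

lemma sqrt_majorant_bounds: "0 \<le> sqrt_majorant n" "sqrt_majorant n \<le> 1"
  by (induction n) (auto simp: power_le_one)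

lemma sqrt_majorant_incseq: "incseq sqrt_majorant"
proof (rule incseq_SucI)
  show "sqrt_majorant n \<le> sqrt_majorant (Suc n)" for n
    using sum_squares_bound[of 1 "sqrt_majorant n"] by simp
qed

lemma sqrt_iter_commute:
  assumes "bounded_clinear C" "\<And>x. C (B x) = B (C x)"
  shows "C (sqrt_iter B n x) = sqrt_iter B n (C x)"
  by (induction n arbitrary: x) (simp_all add: bounded_clinear_simps[OF assms(1)] assms(2))

lemma selfadjoint_sqrt_iter: "selfadjoint B \<Longrightarrow> selfadjoint (sqrt_iter B n)"
proof (induction n)
  case (Suc n)
  have "selfadjoint (\<lambda>x. sqrt_iter B n (sqrt_iter B n x))"
    by (rule selfadjoint_compose[OF Suc.IH[OF Suc.prems] Suc.IH[OF Suc.prems] refl])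
  then show ?case
    unfolding sqrt_iter.simps by (intro selfadjoint_scaleR selfadjoint_add Suc.prems)
qed simp

lemma sqrt_iter_commute_sqrt_iter:
  assumes "selfadjoint B"
  shows "sqrt_iter B m (sqrt_iter B n x) = sqrt_iter B n (sqrt_iter B m x)"
proof (rule sqrt_iter_commute)
  show "bounded_clinear (sqrt_iter B m)"
    by (intro selfadjoint_bounded selfadjoint_sqrt_iter assms)
  show "sqrt_iter B m (B y) = B (sqrt_iter B m y)" for y
    by (rule sqrt_iter_commute[of B B, symmetric]) (simp_all add: selfadjoint_bounded assms)
qed

lemma norm_sqrt_iter_le:
  assumes "\<And>x. norm (B x) \<le> norm x"
  shows "norm (sqrt_iter B n x) \<le> sqrt_majorant n * norm x"
proof (induction n arbitrary: x)
  case (Suc n)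
  have "norm (sqrt_iter B n (sqrt_iter B n x)) \<le> sqrt_majorant n * (sqrt_majorant n * norm x)"
    using Suc order_trans[OF Suc mult_left_mono[OF Suc]] sqrt_majorant_bounds by blast
  then have "norm (B x + sqrt_iter B n (sqrt_iter B n x)) \<le> norm x + sqrt_majorant n * (sqrt_majorant n * norm x)"
    using assms[of x] norm_triangle_ineq order_trans add_mono by metis
  moreover have "norm (sqrt_iter B (Suc n) x) = norm (B x + sqrt_iter B n (sqrt_iter B n x)) / 2"
    by (simp del: scaleR_right_distrib)
  ultimately show ?case
    by (simp add: power2_eq_square algebra_simps)
qed simp

lemma norm_sqrt_iter_step:
  assumes sa: "selfadjoint B" and le: "\<And>x. norm (B x) \<le> norm x"
  shows "norm (sqrt_iter B (Suc n) x - sqrt_iter B n x) \<le> (sqrt_majorant (Suc n) - sqrt_majorant n) * norm x"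
proof (induction n arbitrary: x)
  case 0
  then show ?case using le[of x] by simp
next
  case (Suc n)
  let ?Y = "sqrt_iter B (Suc n)" and ?Z = "sqrt_iter B n"
  let ?y = "sqrt_majorant (Suc n)" and ?z = "sqrt_majorant n"
  let ?u = "?Y x + ?Z x"
  note lin = bounded_clinear_simps[OF selfadjoint_bounded[OF selfadjoint_sqrt_iter[OF sa]]]
  have "sqrt_iter B (Suc (Suc n)) x - ?Y x = (1/2) *\<^sub>R (?Y (?Y x) - ?Z (?Z x))"
    by (simp add: algebra_simps)
  \<comment> \<open>The iterates commute, so Y^2 - Z^2 = (Y - Z) (Y + Z); the majorant obeys the
    same factorisation.\<close>
  also have "?Y (?Y x) - ?Z (?Z x) = ?Y ?u - ?Z ?u"
    using sqrt_iter_commute_sqrt_iter[OF sa, of "Suc n" n x] by (simp add: lin del: sqrt_iter.simps)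
  finally have "norm (sqrt_iter B (Suc (Suc n)) x - ?Y x) = norm (?Y ?u - ?Z ?u) / 2"
    by (simp del: sqrt_iter.simps)
  also have "\<dots> \<le> (?y - ?z) * norm ?u / 2"
    using Suc[of ?u] by (simp del: sqrt_iter.simps sqrt_majorant.simps)
  also have "\<dots> \<le> (?y - ?z) * ((?y + ?z) * norm x) / 2"
  proof -
    have "norm ?u \<le> ?y * norm x + ?z * norm x"
      using norm_sqrt_iter_le[OF le] norm_triangle_mono by blast
    moreover have "0 \<le> ?y - ?z"
      using incseq_SucD[OF sqrt_majorant_incseq] by simp
    ultimately show ?thesis
      by (intro divide_right_mono mult_left_mono) (auto simp: algebra_simps simp del: sqrt_iter.simps sqrt_majorant.simps)
  qed
  also have "\<dots> = (sqrt_majorant (Suc (Suc n)) - ?y) * norm x"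
  proof -
    have z: "?z * ?z = 2 * ?y - 1"
      by (simp add: power2_eq_square field_simps)
    have "(?y - ?z) * (?y + ?z) = 1 + ?y\<^sup>2 - 2 * ?y"
      by (simp add: z algebra_simps power2_eq_square del: sqrt_majorant.simps)
    then have "(?y - ?z) * ((?y + ?z) * norm x) / 2 = (1 + ?y\<^sup>2 - 2 * ?y) * norm x / 2"
      by (simp only: mult.assoc[symmetric])
    then show ?thesis
      unfolding sqrt_majorant.simps(2)[of "Suc n"]
      by (simp add: field_simps del: sqrt_majorant.simps)
  qed
  finally show ?case .
qed

lemma norm_sqrt_iter_diff:
  assumes "selfadjoint B" "\<And>x. norm (B x) \<le> norm x" "n \<le> m"
  shows "norm (sqrt_iter B m x - sqrt_iter B n x) \<le> (sqrt_majorant m - sqrt_majorant n) * norm x"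
  using assms(3)
proof (induction m rule: dec_induct)
  case (step m)
  have "norm (sqrt_iter B (Suc m) x - sqrt_iter B n x)
      \<le> norm (sqrt_iter B (Suc m) x - sqrt_iter B m x) + norm (sqrt_iter B m x - sqrt_iter B n x)"
    using norm_triangle_ineq[of "sqrt_iter B (Suc m) x - sqrt_iter B m x"
        "sqrt_iter B m x - sqrt_iter B n x"] by simp
  also have "\<dots> \<le> (sqrt_majorant (Suc m) - sqrt_majorant m) * norm x
      + (sqrt_majorant m - sqrt_majorant n) * norm x"
    using norm_sqrt_iter_step[OF assms(1,2)] step.IH by (intro add_mono)
  finally show ?case by (simp add: algebra_simps)
qed simp

text \<open>The root is 1 - L with L the limit of the iterates. These are polynomials in B, so
  whatever commutes with B commutes with L. The commutant clause later yields uniqueness of roots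
  and the commutation of spectral projections.\<close>

lemma nonneg_sqrt_exists_contraction:
  fixes B :: "'a::chilbert_space \<Rightarrow> 'a"
  assumes sa: "selfadjoint B" and le: "\<And>x. norm (B x) \<le> norm x"
  shows "\<exists>R. nonneg_op R \<and> (\<forall>x. R (R x) = x - B x) \<and>
    (\<forall>C. bounded_clinear C \<longrightarrow> (\<forall>x. C (B x) = B (C x)) \<longrightarrow> (\<forall>x. C (R x) = R (C x)))"
proof -
  have conv_maj: "convergent sqrt_majorant"
    using sqrt_majorant_bounds(2) sqrt_majorant_incseq
    by (metis Bseq_mono_convergent BseqI' abs_of_nonneg incseqD real_norm_def sqrt_majorant_bounds(1))
  have "Cauchy (\<lambda>n. sqrt_iter B n x)" for x
  proof (rule metric_CauchyI)
    fix e :: real assume "0 < e"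
    then have "0 < e / (norm x + 1)" by (simp add: add_nonneg_pos)
    then obtain N where N: "\<And>m n. N \<le> m \<Longrightarrow> N \<le> n \<Longrightarrow>
        dist (sqrt_majorant m) (sqrt_majorant n) < e / (norm x + 1)"
      using conv_maj Cauchy_convergent_iff[of sqrt_majorant] metric_CauchyD by metis
    have *: "dist (sqrt_iter B m x) (sqrt_iter B n x) < e" if "N \<le> n" "n \<le> m" for m n
    proof -
      have "sqrt_majorant m - sqrt_majorant n < e / (norm x + 1)"
        using N[of m n] that by (simp add: dist_real_def)
      then have "(sqrt_majorant m - sqrt_majorant n) * (norm x + 1) < e"
        by (simp add: pos_less_divide_eq add_nonneg_pos)
      moreover have "sqrt_majorant n \<le> sqrt_majorant m"
        using sqrt_majorant_incseq that(2) by (simp add: incseq_def)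
      ultimately have "(sqrt_majorant m - sqrt_majorant n) * norm x < e"
        by (simp add: algebra_simps)
      then show ?thesis
        using norm_sqrt_iter_diff[OF sa le that(2), of x] by (simp add: dist_norm)
    qed
    show "\<exists>M. \<forall>m\<ge>M. \<forall>n\<ge>M. dist (sqrt_iter B m x) (sqrt_iter B n x) < e"
      using * by (metis dist_commute nle_le)
  qed
  then have "\<exists>l. (\<lambda>n. sqrt_iter B n x) \<longlonglongrightarrow> l" for x
    using Cauchy_convergent convergent_def by blast
  then obtain L where L: "\<And>x. (\<lambda>n. sqrt_iter B n x) \<longlonglongrightarrow> L x"
    by metis
  note lin = bounded_clinear_simps[OF selfadjoint_bounded[OF selfadjoint_sqrt_iter[OF sa]]]
  have iter_le: "norm (sqrt_iter B n x) \<le> norm x" for n x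
    using order_trans[OF norm_sqrt_iter_le[OF le]] mult_right_mono[OF sqrt_majorant_bounds(2), of "norm x"]
    by force
  have L_le: "norm (L x) \<le> norm x" for x
    by (rule LIMSEQ_le_const2[OF tendsto_norm[OF L]]) (use iter_le in blast)
  have L_commute: "C (L x) = L (C x)" if "bounded_clinear C" "\<And>x. C (B x) = B (C x)" for C x
    using bounded_clinear_tendsto[OF that(1) L, of x] L[of "C x"]
    unfolding sqrt_iter_commute[of C B, OF that] by (rule LIMSEQ_unique)
  have L_sa: "selfadjoint L"
    unfolding selfadjoint_def
  proof (intro conjI allI bounded_clinearI[where K=1])
    fix x y c
    show "L (x + y) = L x + L y"
      using L[of "x + y"] tendsto_add[OF L L, of x y] unfolding lin by (rule LIMSEQ_unique)
    show "L (c *\<^sub>C x) = c *\<^sub>C L x"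
    proof -
      \<comment> \<open>Multiplication by c commutes with B, so homogeneity of L is an instance of
        \<open>L_commute\<close>.\<close>
      have "bounded_clinear (\<lambda>x::'a. c *\<^sub>C x)"
        by (rule bounded_clinearI[where K="cmod c"])
          (simp_all add: scaleC_add_right scaleC_scaleC mult.commute norm_scaleC)
      then show ?thesis
        by (rule L_commute[symmetric]) (simp add: bounded_clinear_simps[OF selfadjoint_bounded[OF sa]])
    qed
    show "norm (L x) \<le> 1 * norm x"
      using L_le by simp
    show "cinner (L x) y = cinner x (L y)"
      using tendsto_cinner[OF L tendsto_const, of x y] tendsto_cinner[OF tendsto_const L, of x y]
      unfolding selfadjoint_sym[OF selfadjoint_sqrt_iter[OF sa]] by (rule LIMSEQ_unique)
  qed
  \<comment> \<open>Split into the iterate applied to the error at x, controlled because the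
    iterates are contractions, and the iterate applied to L x.\<close>
  have LL: "(\<lambda>n. sqrt_iter B n (sqrt_iter B n x)) \<longlonglongrightarrow> L (L x)" for x
  proof -
    have "(\<lambda>n. sqrt_iter B n (sqrt_iter B n x - L x)) \<longlonglongrightarrow> 0"
      by (rule Lim_null_comparison[OF _ tendsto_norm_zero[OF LIM_zero[OF L[of x]]]])
        (simp add: iter_le del: sqrt_iter.simps)
    from tendsto_add[OF this L[of "L x"]] show ?thesis
      by (simp add: lin)
  qed
  have L_eq: "L x = (1/2) *\<^sub>R (B x + L (L x))" for x
  proof -
    have "(\<lambda>n. sqrt_iter B (Suc n) x) \<longlonglongrightarrow> (1/2) *\<^sub>R (B x + L (L x))"
      unfolding sqrt_iter.simps by (intro tendsto_intros LL)
    then show ?thesis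
      using LIMSEQ_Suc[OF L[of x]] LIMSEQ_unique by blast
  qed
  show ?thesis
  proof (intro exI[of _ "\<lambda>x. x - L x"] conjI allI impI)
    show "nonneg_op (\<lambda>x. x - L x)"
    proof -
      have "Re (cinner x (L x)) \<le> norm x * norm x" for x
        using complex_Re_le_cmod Cauchy_Schwarz[of x "L x"] mult_left_mono[OF L_le norm_ge_zero]
        by (meson order_trans)
      then show ?thesis
        by (simp add: nonneg_op_def selfadjoint_diff L_sa cinner_diff_right power2_eq_square)
    qed
    show "x - L x - L (x - L x) = x - B x" for x
    proof -
      have "L x + L x = B x + L (L x)"
        using arg_cong[OF L_eq[of x], of "\<lambda>y. 2 *\<^sub>R y"] by (simp add: scaleR_2)
      then show ?thesis
        by (simp add: bounded_clinear_simps[OF selfadjoint_bounded[OF L_sa]] algebra_simps)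
    qed
    show "C (x - L x) = C x - L (C x)" if "bounded_clinear C" "\<forall>x. C (B x) = B (C x)" for C x
      using L_commute[OF that(1)] that(2) by (simp add: bounded_clinear_simps[OF that(1)])
  qed
qed

text \<open>Scaling: B = 1 - T / K lies between 0 and 1, and T = K (1 - B), hence the factor
  \<open>sqrt K\<close>.\<close>

lemma nonneg_sqrt_exists:
  fixes T :: "'a::chilbert_space \<Rightarrow> 'a"
  assumes T: "nonneg_op T"
  shows "\<exists>R. nonneg_op R \<and> (\<forall>x. R (R x) = T x) \<and>
    (\<forall>C. bounded_clinear C \<longrightarrow> (\<forall>x. C (T x) = T (C x)) \<longrightarrow> (\<forall>x. C (R x) = R (C x)))"
proof -
  note T_sa = nonneg_opD(1)[OF T]
  obtain K where K: "0 < K" "\<And>x. norm (T x) \<le> K * norm x"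
    using bounded_clinear_bound[OF selfadjoint_bounded[OF T_sa]] by blast
  define B where "B = (\<lambda>x. x - (1/K) *\<^sub>R T x)"
  have B_sa: "selfadjoint B"
    unfolding B_def by (intro selfadjoint_diff selfadjoint_id selfadjoint_scaleR T_sa)
  have "Re (cinner x (T x)) \<le> K * (norm x)\<^sup>2" for x
  proof -
    have "Re (cinner x (T x)) \<le> norm x * norm (T x)"
      using complex_Re_le_cmod Cauchy_Schwarz order_trans by blast
    also have "\<dots> \<le> norm x * (K * norm x)"
      using K by (intro mult_left_mono) auto
    finally show ?thesis by (simp add: power2_eq_square mult_ac)
  qed
  then have "nonneg_op B"
    using B_sa K(1) by (simp add: nonneg_op_def B_def cinner_diff_right field_simps)
  then have "norm (B x) \<le> norm x" for x
    using nonneg_opD(2)[OF T] K(1)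
    by (intro nonneg_op_contraction) (auto simp: B_def cinner_diff_right)
  then obtain R where R: "nonneg_op R" "\<And>x. R (R x) = x - B x"
    "\<And>C x. bounded_clinear C \<Longrightarrow> (\<And>x. C (B x) = B (C x)) \<Longrightarrow> C (R x) = R (C x)"
    using nonneg_sqrt_exists_contraction[OF B_sa] by blast
  note R_lin = bounded_clinear_simps[OF selfadjoint_bounded[OF nonneg_opD(1)[OF R(1)]]]
  show ?thesis
  proof (intro exI[of _ "\<lambda>x. sqrt K *\<^sub>R R x"] conjI allI impI)
    show "nonneg_op (\<lambda>x. sqrt K *\<^sub>R R x)"
      using R(1) K(1) by (auto simp: nonneg_op_def selfadjoint_scaleR)
    show "sqrt K *\<^sub>R R (sqrt K *\<^sub>R R x) = T x" for x
      using K(1) by (simp add: R_lin R(2) B_def)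
    show "C (sqrt K *\<^sub>R R x) = sqrt K *\<^sub>R R (C x)"
      if "bounded_clinear C" "\<forall>x. C (T x) = T (C x)" for C x
      using R(3)[OF that(1)] that(2) by (simp add: bounded_clinear_simps[OF that(1)] B_def)
  qed
qed

text \<open>For y = R x - Q x, commutation gives (R + Q) y = 0. Two nonnegative forms with sum 0 at
  y both vanish, so R y = Q y = 0 and y is orthogonal to itself.\<close>

lemma nonneg_sqrt_unique:
  assumes R: "nonneg_op R" and Q: "nonneg_op Q"
    and eq: "\<And>x. R (R x) = Q (Q x)" and comm: "\<And>x. Q (R x) = R (Q x)"
  shows "R = Q"
proof
  fix x
  note lin = bounded_clinear_simps[OF selfadjoint_bounded[OF nonneg_opD(1)[OF R]]]
    bounded_clinear_simps[OF selfadjoint_bounded[OF nonneg_opD(1)[OF Q]]]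
  define y where "y = R x - Q x"
  have "R y + Q y = 0"
    using eq[of x] comm[of x] by (simp add: y_def lin)
  then have sum: "Re (cinner y (R y)) + Re (cinner y (Q y)) = 0"
    by (metis cinner_add_right cinner_zero(2) plus_complex.sel(1) zero_complex.sel(1))
  have "R y = 0"
    using sum nonneg_opD(2)[OF Q, of y] by (intro nonneg_op_eq_0[OF R]) linarith
  moreover have "Q y = 0"
    using sum nonneg_opD(2)[OF R, of y] by (intro nonneg_op_eq_0[OF Q]) linarith
  ultimately have "cinner y y = 0"
    using selfadjoint_sym[OF nonneg_opD(1)[OF R], of x y] selfadjoint_sym[OF nonneg_opD(1)[OF Q], of x y]
    by (subst y_def) (simp add: cinner_diff_left)
  then show "R x = Q x"
    by (simp add: y_def)
qed

lemma op_sqrt_ex1: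
  fixes T :: "'a::chilbert_space \<Rightarrow> 'a"
  assumes T: "nonneg_op T"
  shows "\<exists>R. op_sqrt T = R \<and> nonneg_op R \<and> (\<forall>x. R (R x) = T x) \<and>
    (\<forall>C x. bounded_clinear C \<longrightarrow> (\<forall>x. C (T x) = T (C x)) \<longrightarrow> C (R x) = R (C x))"
proof -
  obtain R where R: "nonneg_op R" "\<And>x. R (R x) = T x"
    "\<And>C x. bounded_clinear C \<Longrightarrow> (\<And>x. C (T x) = T (C x)) \<Longrightarrow> C (R x) = R (C x)"
    using nonneg_sqrt_exists[OF T] by blast
  have "op_sqrt T = R"
    unfolding op_sqrt_def
  proof (rule the_equality)
    show "nonneg_op R \<and> R \<circ> R = T"
      using R by auto
    fix Q assume "nonneg_op Q \<and> Q \<circ> Q = T"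
    then have Q: "nonneg_op Q" "\<And>x. Q (Q x) = T x" by auto
    \<comment> \<open>A competing root Q commutes with its own square T, hence with R by the
      commutant clause.\<close>
    then have "Q (R x) = R (Q x)" for x
      using R(3)[OF selfadjoint_bounded[OF nonneg_opD(1)[OF Q(1)]], of x] by (simp flip: Q(2))
    then show "Q = R"
      by (intro nonneg_sqrt_unique Q(1) R(1)) (simp_all add: R(2) Q(2))
  qed
  then show ?thesis using R by blast
qed

lemma op_sqrt:
  fixes T :: "'a::chilbert_space \<Rightarrow> 'a"
  assumes "nonneg_op T"
  shows "nonneg_op (op_sqrt T)" "op_sqrt T (op_sqrt T x) = T x"
    "bounded_clinear C \<Longrightarrow> (\<And>x. C (T x) = T (C x)) \<Longrightarrow> C (op_sqrt T x) = op_sqrt T (C x)"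
proof -
  obtain R where R: "op_sqrt T = R" "nonneg_op R" "\<forall>x. R (R x) = T x"
    "\<forall>C x. bounded_clinear C \<longrightarrow> (\<forall>x. C (T x) = T (C x)) \<longrightarrow> C (R x) = R (C x)"
    using op_sqrt_ex1[OF assms] by (elim exE conjE) (rule that)
  show "nonneg_op (op_sqrt T)" "op_sqrt T (op_sqrt T x) = T x"
    unfolding R(1) by (rule R(2), rule R(3)[rule_format])
  show "C (op_sqrt T x) = op_sqrt T (C x)" if C: "bounded_clinear C" "\<And>x. C (T x) = T (C x)"
    unfolding R(1) by (rule R(4)[rule_format, of C, OF C])
qed

lemma op_sqrt_eqI:
  fixes T :: "'a::chilbert_space \<Rightarrow> 'a"
  assumes "nonneg_op Q" "\<And>x. Q (Q x) = T x"
  shows "op_sqrt T = Q"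
proof -
  have T: "nonneg_op T"
    using selfadjoint_square_nonneg[OF nonneg_opD(1)[OF assms(1)]] unfolding assms(2) .
  have "Q (op_sqrt T x) = op_sqrt T (Q x)" for x
    by (rule op_sqrt(3)[OF T selfadjoint_bounded[OF nonneg_opD(1)[OF assms(1)]]])
      (simp flip: assms(2))
  then show ?thesis
    by (intro nonneg_sqrt_unique op_sqrt(1)[OF T] assms(1)) (simp_all add: op_sqrt(2)[OF T] assms(2))
qed

lemma op_abs:
  fixes X :: "'a::chilbert_space \<Rightarrow> 'a"
  assumes "selfadjoint X"
  shows "nonneg_op (op_abs X)" "op_abs X (op_abs X x) = X (X x)"
    "bounded_clinear C \<Longrightarrow> (\<And>x. C (X x) = X (C x)) \<Longrightarrow> C (op_abs X x) = op_abs X (C x)"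
proof -
  note sq = op_sqrt[OF selfadjoint_square_nonneg[OF assms]]
  show "nonneg_op (op_abs X)" "op_abs X (op_abs X x) = X (X x)"
    unfolding op_abs_def comp_def by (rule sq(1), rule sq(2))
  show "C (op_abs X x) = op_abs X (C x)" if C: "bounded_clinear C" "\<And>x. C (X x) = X (C x)"
    unfolding op_abs_def comp_def by (rule sq(3)[of C, OF C(1)]) (simp add: C(2))
qed

section \<open>Spectral cuts\<close>

text \<open>C P = P C P is selfadjoint, so it equals its adjoint P C.\<close>

lemma orth_projection_commute:
  assumes P: "orth_projection P" and C: "selfadjoint C" and inv: "\<And>x. P (C (P x)) = C (P x)"
  shows "P (C x) = C (P x)"
proof (rule cinner_eqI)
  fix z
  have "cinner z (P (C x)) = cinner (P (C (P z))) x"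
    by (simp add: inv orth_projection_sym[OF P] selfadjoint_sym[OF C])
  also have "\<dots> = cinner z (P (C (P x)))"
    by (simp add: orth_projection_sym[OF P] selfadjoint_sym[OF C])
  finally show "cinner z (P (C x)) = cinner z (C (P x))"
    by (simp add: inv)
qed

text \<open>\<open>spectral_cut (\<lambda>x. X x - t *\<^sub>R x) P\<close> characterises \<open>P = E\<^sub>t\<close>.\<close>

definition spectral_cut :: "('a::complex_inner \<Rightarrow> 'a) \<Rightarrow> ('a \<Rightarrow> 'a) \<Rightarrow> bool" where
  "spectral_cut Y P \<longleftrightarrow> orth_projection P \<and> (\<forall>x. P (Y x) = Y (P x)) \<and>
     (\<forall>x. P x = x \<longrightarrow> Re (cinner x (Y x)) \<le> 0) \<and>
     (\<forall>x. P x = 0 \<longrightarrow> x \<noteq> 0 \<longrightarrow> 0 < Re (cinner x (Y x)))"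

lemma spectral_cutD:
  assumes "spectral_cut Y P"
  shows "orth_projection P" "P (Y x) = Y (P x)" "P x = x \<Longrightarrow> Re (cinner x (Y x)) \<le> 0"
    "P x = 0 \<Longrightarrow> x \<noteq> 0 \<Longrightarrow> 0 < Re (cinner x (Y x))"
  using assms by (auto simp: spectral_cut_def)

text \<open>\<open>P\<close> is the projection onto the kernel of \<open>|Y| + Y\<close>, twice the positive part of \<open>Y\<close>.\<close>

lemma spectral_cut_exists:
  fixes Y :: "'a::chilbert_space \<Rightarrow> 'a"
  assumes Y: "selfadjoint Y"
  obtains P where "spectral_cut Y P"
    "\<forall>C. selfadjoint C \<longrightarrow> (\<forall>x. C (Y x) = Y (C x)) \<longrightarrow> (\<forall>x. P (C x) = C (P x))"
proof -
  define M where "M = op_abs Y"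
  have M: "nonneg_op M" "\<And>x. M (M x) = Y (Y x)"
    using op_abs(1,2)[OF Y] by (simp_all add: M_def)
  note M_sa = nonneg_opD(1)[OF M(1)]
  note lin = bounded_clinear_simps[OF selfadjoint_bounded[OF Y]]
    bounded_clinear_simps[OF selfadjoint_bounded[OF M_sa]]
  have M_commute: "C (M x) = M (C x)" if "bounded_clinear C" "\<And>x. C (Y x) = Y (C x)" for C x
    unfolding M_def by (rule op_abs(3)[of Y C, OF Y that])
  have YM: "Y (M x) = M (Y x)" for x
    by (rule M_commute[of Y, OF selfadjoint_bounded[OF Y] refl])
  define V where "V = {x. M x + Y x = 0}"
  have V_sub: "complex_vector.subspace V"
    unfolding V_def
  proof (rule complex_vector.subspaceI)
    show "x + y \<in> {x. M x + Y x = 0}" if "x \<in> {x. M x + Y x = 0}" "y \<in> {x. M x + Y x = 0}" for x y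
    proof -
      have "M (x + y) + Y (x + y) = (M x + Y x) + (M y + Y y)"
        by (simp add: lin)
      with that show ?thesis by simp
    qed
    show "c *\<^sub>C x \<in> {x. M x + Y x = 0}" if "x \<in> {x. M x + Y x = 0}" for c x
      using that by (simp add: lin flip: scaleC_add_right)
  qed (simp add: lin)
  have "continuous_on UNIV (\<lambda>x. M x + Y x)"
    using Y M_sa by (intro continuous_on_add linear_continuous_on)
      (auto simp: selfadjoint_def bounded_clinear_def)
  then have "closed V"
    unfolding V_def by (intro closed_Collect_eq) auto
  obtain P where P: "orth_projection P" "range P = V"
    by (rule orth_projection_onto[OF V_sub \<open>closed V\<close>])
  have PV: "P x = x \<longleftrightarrow> x \<in> V" for x
    using P orth_projection_idem[OF P(1)] by (metis imageE rangeI)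
  have in_V: "M (P x) + Y (P x) = 0" for x
    using P(2) by (auto simp: V_def)
  have comm: "P (C x) = C (P x)" if C: "selfadjoint C" "\<And>x. C (Y x) = Y (C x)" for C x
  proof (rule orth_projection_commute[OF P(1) C(1)])
    note C' = selfadjoint_bounded[OF C(1)]
    fix x
    have "M (C (P x)) + Y (C (P x)) = C (M (P x) + Y (P x))"
      using M_commute[OF C' C(2)] C(2) by (simp add: bounded_clinear_simps[OF C'])
    then show "P (C (P x)) = C (P x)"
      by (simp add: PV V_def in_V bounded_clinear_simps[OF C'])
  qed
  have "spectral_cut Y P"
    unfolding spectral_cut_def
  proof (intro conjI allI impI)
    show "orth_projection P" by (rule P(1))
    show "P (Y x) = Y (P x)" for x
      by (rule comm[OF Y refl])
    show "Re (cinner x (Y x)) \<le> 0" if "P x = x" for x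
    proof -
      have "Y x = - M x"
        using in_V[of x] that by (simp add: add_eq_0_iff)
      then show ?thesis
        using nonneg_opD(2)[OF M(1)] by simp
    qed
    show "0 < Re (cinner x (Y x))" if "P x = 0" "x \<noteq> 0" for x
    proof -
      \<comment> \<open>Since (M + Y) (M - Y) = 0, the vector M w - Y w lies in V and is orthogonal
        to x; moving M - Y across the inner product turns this into <w, w> = 0.\<close>
      have "M x - Y x = 0"
      proof -
        define w where "w = M x - Y x"
        have "M (M w - Y w) + Y (M w - Y w) = 0"
          by (simp add: lin M(2) YM)
        then have "P (M w - Y w) = M w - Y w"
          by (simp add: PV V_def)
        then have "cinner (M w - Y w) x = 0"
          using that(1) orth_projection_sym[OF P(1), of "M w - Y w" x] by simp
        then have "cinner w w = 0"
          by (simp add: w_def[of] cinner_simps selfadjoint_sym[OF Y] selfadjoint_sym[OF M_sa] lin)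
        then show ?thesis by (simp add: w_def)
      qed
      then have eq: "Y x = M x" by simp
      \<comment> \<open>A nonpositive form would force M x = 0, hence Y x = 0 and x in V. The kernel
        of Y belongs to the range of P, which makes positivity strict off it.\<close>
      show ?thesis
      proof (rule ccontr)
        assume "\<not> ?thesis"
        then have "M x = 0"
          using eq by (intro nonneg_op_eq_0[OF M(1)]) simp
        then have "P x = x"
          by (simp add: PV V_def eq)
        with that show False by simp
      qed
    qed
  qed
  then show thesis
    using comm by (intro that) auto
qed

text \<open>The form of Y splits over the range and the kernel of P, and subtracting 2 P Y flips the
  sign exactly on the nonpositive part. The result squares to Y^2, so uniqueness of roots identifies
  it.\<close>

lemma spectral_cut_abs:
  fixes Y :: "'a::chilbert_space \<Rightarrow> 'a"
  assumes Y: "selfadjoint Y" and cut: "spectral_cut Y P"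
  shows "op_abs Y = (\<lambda>x. Y x - 2 *\<^sub>R P (Y x))"
  unfolding op_abs_def
proof (rule op_sqrt_eqI)
  note P = spectral_cutD(1)[OF cut] and comm = spectral_cutD(2)[OF cut]
  note lin = bounded_clinear_simps[OF selfadjoint_bounded[OF Y]]
    bounded_clinear_simps[OF orth_projection_bounded[OF P]]
  have P_sa: "selfadjoint P"
    using P by (simp add: orth_projection_def)
  have "0 \<le> Re (cinner x (Y x - 2 *\<^sub>R P (Y x)))" for x
  proof -
    define u v where "u = P x" and "v = x - u"
    have u: "P u = u" and v: "P v = 0" and x: "x = u + v"
      by (simp_all add: u_def v_def lin orth_projection_idem[OF P])
    have "cinner u (Y v) = cinner u (P (Y v))"
      using orth_projection_sym[OF P, of u "Y v"] u by simp
    then have uv: "cinner u (Y v) = 0"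
      by (simp add: comm v lin)
    then have vu: "cinner v (Y u) = 0"
      by (metis cinner_commute complex_cnj_zero selfadjoint_sym[OF Y])
    have "cinner x (P (Y x)) = cinner u (Y u)"
      by (simp add: x comm lin u v cinner_add_left vu)
    moreover have "cinner x (Y x) = cinner u (Y u) + cinner v (Y v)"
      by (simp add: x lin cinner_simps uv vu)
    moreover have "Re (cinner u (Y u)) \<le> 0"
      by (rule spectral_cutD(3)[OF cut u])
    moreover have "0 \<le> Re (cinner v (Y v))"
      using spectral_cutD(4)[OF cut v] by (cases "v = 0") (auto simp: lin)
    ultimately show ?thesis
      by (simp add: cinner_diff_right)
  qed
  then show "nonneg_op (\<lambda>x. Y x - 2 *\<^sub>R P (Y x))"
    using selfadjoint_compose[OF P_sa Y comm]
    by (simp add: nonneg_op_def Y selfadjoint_diff selfadjoint_scaleR)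
  show "Y (Y x - 2 *\<^sub>R P (Y x)) - 2 *\<^sub>R P (Y (Y x - 2 *\<^sub>R P (Y x))) = (Y \<circ> Y) x" for x
    using scaleR_left_distrib[of 2 2 "P (Y (Y x))"]
    by (simp add: lin comm[symmetric] orth_projection_idem[OF P] algebra_simps)
qed

text \<open>Comparing absolute values yields only P Y = Q Y, which puts d = P x - Q x into the
  kernel of Y. There the strict clause of \<open>spectral_cut\<close> decides: both projections fix
  d, so <d, d> = <P d - Q d, x> = 0.\<close>

lemma spectral_cut_unique:
  fixes Y :: "'a::chilbert_space \<Rightarrow> 'a"
  assumes Y: "selfadjoint Y" and P: "spectral_cut Y P" and Q: "spectral_cut Y Q"
  shows "P = Q"
proof
  fix x
  note lin = bounded_clinear_simps[OF selfadjoint_bounded[OF Y]]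
    bounded_clinear_simps[OF orth_projection_bounded[OF spectral_cutD(1)[OF P]]]
    bounded_clinear_simps[OF orth_projection_bounded[OF spectral_cutD(1)[OF Q]]]
  define d where "d = P x - Q x"
  have "Y x - 2 *\<^sub>R P (Y x) = Y x - 2 *\<^sub>R Q (Y x)"
    using spectral_cut_abs[OF Y P] spectral_cut_abs[OF Y Q] by metis
  then have Yd: "Y d = 0"
    by (simp add: d_def lin spectral_cutD(2)[OF P] spectral_cutD(2)[OF Q])
  have d_fixed: "R d = d" if R: "spectral_cut Y R" for R
  proof (rule ccontr)
    note linR = bounded_clinear_simps[OF orth_projection_bounded[OF spectral_cutD(1)[OF R]]]
    assume "R d \<noteq> d"
    then have "0 < Re (cinner (d - R d) (Y (d - R d)))"
      by (intro spectral_cutD(4)[OF R])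
        (simp_all add: linR orth_projection_idem[OF spectral_cutD(1)[OF R]])
    moreover have "Y (d - R d) = 0"
      by (simp add: lin Yd linR flip: spectral_cutD(2)[OF R])
    ultimately show False by simp
  qed
  have "cinner d d = cinner (P d) x - cinner (Q d) x"
    by (subst (2) d_def) (simp add: cinner_diff_right orth_projection_sym[OF spectral_cutD(1)[OF P]]
        orth_projection_sym[OF spectral_cutD(1)[OF Q]])
  also have "\<dots> = 0"
    by (simp add: d_fixed[OF P] d_fixed[OF Q])
  finally show "P x = Q x"
    by (simp add: d_def)
qed

text \<open>For n \<le> m, |D n x - D m x|^2 = |D n x|^2 - |D m x|^2, and the squared norms
  decrease. That every \<open>D n\<close> fixes the limit is what later shows the limit to be
  0.\<close>

lemma decreasing_orth_projections_converge:
  fixes D :: "nat \<Rightarrow> 'a::chilbert_space \<Rightarrow> 'a"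
  assumes D: "\<And>n. orth_projection (D n)" and dec: "\<And>m n x. n \<le> m \<Longrightarrow> D n (D m x) = D m x"
  obtains z where "(\<lambda>n. D n x) \<longlonglongrightarrow> z" "\<And>n. D n z = z"
proof -
  have dec': "D m (D n x) = D m x" if "n \<le> m" for m n x
    by (rule cinner_eqI) (simp add: dec[OF that] flip: orth_projection_sym[OF D])
  have diff: "(norm (D n x - D m x))\<^sup>2 = (norm (D n x))\<^sup>2 - (norm (D m x))\<^sup>2" if "n \<le> m" for m n
    using norm_orth_projection_split[OF D, of "D n x" m] dec'[OF that] by simp
  have "decseq (\<lambda>n. (norm (D n x))\<^sup>2)"
    unfolding decseq_def
  proof (intro allI impI power_mono)
    show "norm (D m x) \<le> norm (D n x)" if "n \<le> m" for m n
      using norm_orth_projection_le[OF D, of m "D n x"] dec'[OF that] by simp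
  qed simp
  then obtain l where "(\<lambda>n. (norm (D n x))\<^sup>2) \<longlonglongrightarrow> l"
    using decseq_convergent[of "\<lambda>n. (norm (D n x))\<^sup>2" 0] by auto
  then have C: "Cauchy (\<lambda>n. (norm (D n x))\<^sup>2)"
    by (rule LIMSEQ_imp_Cauchy)
  have "Cauchy (\<lambda>n. D n x)"
  proof (rule metric_CauchyI)
    fix e :: real assume "0 < e"
    then obtain N where N: "\<And>m n. N \<le> m \<Longrightarrow> N \<le> n \<Longrightarrow>
        dist ((norm (D m x))\<^sup>2) ((norm (D n x))\<^sup>2) < e\<^sup>2"
      using metric_CauchyD[OF C, of "e\<^sup>2"] by auto
    have *: "dist (D n x) (D m x) < e" if "N \<le> n" "n \<le> m" for m n
    proof -
      have "(norm (D n x - D m x))\<^sup>2 < e\<^sup>2"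
        using N[of n m] that diff[OF that(2)] by (simp add: dist_real_def)
      then show ?thesis
        using \<open>0 < e\<close> by (simp add: dist_norm power_less_imp_less_base)
    qed
    show "\<exists>M. \<forall>m\<ge>M. \<forall>n\<ge>M. dist (D m x) (D n x) < e"
      using * by (metis dist_commute nle_le)
  qed
  then obtain z where z: "(\<lambda>n. D n x) \<longlonglongrightarrow> z"
    using Cauchy_convergent convergent_def by blast
  have "D n z = z" for n
  proof (rule LIMSEQ_unique)
    show "(\<lambda>m. D n (D m x)) \<longlonglongrightarrow> D n z"
      by (rule bounded_clinear_tendsto[OF orth_projection_bounded[OF D] z])
    show "(\<lambda>m. D n (D m x)) \<longlonglongrightarrow> z"
      using z by (rule Lim_transform_eventually)
        (use dec in \<open>auto simp: eventually_sequentially intro!: exI[of _ n]\<close>)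
  qed
  with z show thesis by (rule that)
qed

section \<open>Lebesgue-Stieltjes integrals\<close>

text \<open>F is not normalised, because the total mass will be |x|^2. It vanishes at m itself, so
  there is no atom at the lower end and the mass lies in (m, M].\<close>

locale bounded_distribution =
  fixes F :: "real \<Rightarrow> real" and m M :: real
  assumes mono: "s \<le> t \<Longrightarrow> F s \<le> F t"
    and right_cont: "continuous (at_right t) F"
    and zero: "s \<le> m \<Longrightarrow> F s = 0"
    and const: "M \<le> s \<Longrightarrow> F s = F M"
    and m_le_M: "m \<le> M"
begin

abbreviation "\<mu> \<equiv> interval_measure F"

lemma emeasure_Ioc: "s \<le> t \<Longrightarrow> emeasure \<mu> {s<..t} = F t - F s"
  by (rule emeasure_interval_measure_Ioc[OF _ mono right_cont])

lemma AE_Ioc: "AE t in \<mu>. m < t \<and> t \<le> M"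
proof -
  have "(\<Union>n. {m - real n<..m}) \<in> null_sets \<mu>"
    by (rule null_sets_UN) (auto simp: null_sets_def emeasure_Ioc zero)
  moreover have "(\<Union>n. {m - real n<..m}) = {..m}"
    using reals_Archimedean2[of "m - _"] by (auto simp: algebra_simps)
  ultimately have 1: "{..m} \<in> null_sets \<mu>" by simp
  have "F (M + real n) = F M" for n
    by (intro const) simp
  then have "(\<Union>n. {M<..M + real n}) \<in> null_sets \<mu>"
    by (intro null_sets_UN) (auto simp: null_sets_def emeasure_Ioc)
  moreover have "(\<Union>n. {M<..M + real n}) = {M<..}"
    using reals_Archimedean2[of "_ - M"] by (auto simp: algebra_simps) (metis add.commute less_eq_real_def)
  ultimately have 2: "{M<..} \<in> null_sets \<mu>" by simp
  show ?thesis
    using AE_not_in[OF 1] AE_not_in[OF 2] by eventually_elim auto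
qed

lemma emeasure_UNIV: "emeasure \<mu> UNIV = F M"
proof -
  have "emeasure \<mu> UNIV = emeasure \<mu> {m<..M}"
    by (intro emeasure_eq_AE eventually_mono[OF AE_Ioc]) auto
  then show ?thesis
    using m_le_M by (simp add: emeasure_Ioc zero)
qed

lemma finite_measure: "finite_measure \<mu>"
  by (rule finite_measureI) (simp add: emeasure_UNIV)

lemma measure_UNIV: "measure \<mu> UNIV = F M"
  using mono[OF m_le_M] zero[of m] by (simp add: measure_def emeasure_UNIV)

lemma measure_Ioc: "s \<le> t \<Longrightarrow> measure \<mu> {s<..t} = F t - F s"
  using mono by (simp add: measure_def emeasure_Ioc)

lemma measure_atMost: "measure \<mu> {..s} = F s"
proof -
  have "measure \<mu> {..s} = measure \<mu> {min s m<..s}"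
    by (intro measure_eq_AE eventually_mono[OF AE_Ioc]) auto
  then show ?thesis
    by (simp add: measure_Ioc zero)
qed

text \<open>The mass of the open half line is the left limit of F. The value of F at a would include
  an atom at a, which for a = 0 stems from the kernel of X.\<close>

lemma tendsto_measure_lessThan:
  "(\<lambda>n. F (a - 1 / real (Suc n))) \<longlonglongrightarrow> measure \<mu> {..<a}"
proof -
  interpret finite_measure \<mu> by (rule finite_measure)
  have "(\<Union>n. {..a - 1 / real (Suc n)}) = {..<a}"
  proof (intro set_eqI iffI)
    fix x assume "x \<in> {..<a}"
    then obtain n where "inverse (real (Suc n)) < a - x"
      using reals_Archimedean[of "a - x"] by auto
    then have "x \<le> a - 1 / real (Suc n)"
      by (simp add: inverse_eq_divide)
    then show "x \<in> (\<Union>n. {..a - 1 / real (Suc n)})"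
      by blast
  next
    fix x assume "x \<in> (\<Union>n. {..a - 1 / real (Suc n)})"
    then obtain n where "x \<le> a - 1 / real (Suc n)" by auto
    moreover have "0 < 1 / real (Suc n)" by simp
    ultimately have "x < a" by linarith
    then show "x \<in> {..<a}" by simp
  qed
  moreover have "incseq (\<lambda>n. {..a - 1 / real (Suc n)})"
    by (intro incseq_SucI) (auto simp: frac_le intro: order_trans)
  ultimately show ?thesis
    using finite_Lim_measure_incseq[of "\<lambda>n. {..a - 1 / real (Suc n)}"]
    by (simp add: measure_atMost image_subset_iff)
qed

text \<open>The function \<open>b\<close> is \<open>s \<mapsto> \<integral>\<^bsub>(-\<infinity>, s]\<^esub> t dF(t)\<close>.\<close>

lemma stieltjes_primitive:
  obtains b where "\<And>s t. s \<le> t \<Longrightarrow> s * (F t - F s) \<le> b t - b s"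
    "\<And>s t. s \<le> t \<Longrightarrow> b t - b s \<le> t * (F t - F s)"
    "(LINT t|\<mu>. t) = b M - b m"
proof -
  interpret finite_measure \<mu> by (rule finite_measure)
  have int: "integrable \<mu> (\<lambda>t. t)"
    by (rule integrable_const_bound[where B="\<bar>m\<bar> + \<bar>M\<bar>", OF eventually_mono[OF AE_Ioc]]) auto
  define b where "b = (\<lambda>s. LINT t|\<mu>. indicator {..s} t * t)"
  have int_b: "integrable \<mu> (\<lambda>t. indicator {..s} t * t)" for s
    using integrable_mult_indicator[OF _ int, of "{..s}"] by simp
  have diff: "b t - b s = (LINT r|\<mu>. indicator {s<..t} r * r)" if "s \<le> t" for s t
  proof -
    have "b t - b s = (LINT r|\<mu>. indicator {..t} r * r - indicator {..s} r * r)"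
      unfolding b_def by (rule Bochner_Integration.integral_diff[symmetric]) (rule int_b)+
    also have "\<dots> = (LINT r|\<mu>. indicator {s<..t} r * r)"
      using that by (intro Bochner_Integration.integral_cong) (auto simp: indicator_def)
    finally show ?thesis .
  qed
  have int_d: "integrable \<mu> (\<lambda>r. indicator {s<..t} r * r)" for s t
    using integrable_mult_indicator[OF _ int, of "{s<..t}"] by simp
  have int_e: "integrable \<mu> (\<lambda>r. indicator {s<..t} r * a)" for s t a :: real
    by (intro integrable_mult_left integrable_real_indicator) (auto simp: emeasure_finite less_top[symmetric])
  have val: "(LINT r|\<mu>. indicator {s<..t} r * a) = a * (F t - F s)" if "s \<le> t" for s t a
    using that by (simp add: measure_Ioc)
  show thesis
  proof
    show "s * (F t - F s) \<le> b t - b s" if "s \<le> t" for s t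
      unfolding diff[OF that] val[OF that, symmetric]
      by (rule integral_mono[OF int_e int_d]) (auto simp: indicator_def)
    show "b t - b s \<le> t * (F t - F s)" if "s \<le> t" for s t
      unfolding diff[OF that] val[OF that, symmetric]
      by (rule integral_mono[OF int_d int_e]) (auto simp: indicator_def)
    show "(LINT t|\<mu>. t) = b M - b m"
      unfolding diff[OF m_le_M]
      by (intro integral_cong_AE eventually_mono[OF AE_Ioc]) auto
  qed
qed

end

text \<open>Over n + 1 pieces of equal length h the bounds telescope to h (F t - F s), and h tends
  to 0.\<close>

lemma increments_squeezed_imp_const:
  fixes d F :: "real \<Rightarrow> real"
  assumes d: "\<And>s t. s \<le> t \<Longrightarrow> \<bar>d t - d s\<bar> \<le> (t - s) * (F t - F s)" and st: "s \<le> t"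
  shows "d t = d s"
proof -
  have le: "\<bar>d t - d s\<bar> \<le> (t - s) * (F t - F s) / real (Suc n)" for n
  proof -
    define h where "h = (t - s) / real (Suc n)"
    have h: "0 \<le> h" "s + real (Suc n) * h = t"
      using st by (simp_all add: h_def del: of_nat_Suc)
    have "\<bar>d (s + real k * h) - d s\<bar> \<le> h * (F (s + real k * h) - F s)" for k
    proof (induction k)
      case (Suc k)
      have "\<bar>d (s + real (Suc k) * h) - d (s + real k * h)\<bar>
          \<le> h * (F (s + real (Suc k) * h) - F (s + real k * h))"
        using d[of "s + real k * h" "s + real (Suc k) * h"] h(1) by (simp add: algebra_simps)
      then show ?case
        using Suc by (simp add: right_diff_distrib del: of_nat_Suc)
    qed simp
    from this[of "Suc n"] show ?thesis
      unfolding h(2) by (simp add: h_def del: of_nat_Suc)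
  qed
  have "(\<lambda>n. (t - s) * (F t - F s) * (1 / real (Suc n))) \<longlonglongrightarrow> (t - s) * (F t - F s) * 0"
    by (intro tendsto_mult tendsto_const LIMSEQ_Suc[OF lim_1_over_n])
  then have "\<bar>d t - d s\<bar> \<le> (t - s) * (F t - F s) * 0"
    by (rule LIMSEQ_le_const) (use le in auto)
  then show ?thesis by simp
qed

text \<open>The two-sided bounds determine a function up to a constant, since the difference of two
  solutions has increments of size at most (t - s) (F t - F s). An integral of t is thus evaluated
  by exhibiting any function with these bounds.\<close>

lemma stieltjes_primitive_unique:
  fixes a b F :: "real \<Rightarrow> real"
  assumes "\<And>s t. s \<le> t \<Longrightarrow> s * (F t - F s) \<le> a t - a s"
    "\<And>s t. s \<le> t \<Longrightarrow> a t - a s \<le> t * (F t - F s)"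
    "\<And>s t. s \<le> t \<Longrightarrow> s * (F t - F s) \<le> b t - b s"
    "\<And>s t. s \<le> t \<Longrightarrow> b t - b s \<le> t * (F t - F s)" and "s \<le> t"
  shows "a t - a s = b t - b s"
proof -
  have "a t - b t = a s - b s"
  proof (rule increments_squeezed_imp_const[of "\<lambda>t. a t - b t" F])
    show "\<bar>(a t - b t) - (a s - b s)\<bar> \<le> (t - s) * (F t - F s)" if "s \<le> t" for s t
      using assms(1-4)[OF that] by (simp add: left_diff_distrib)
  qed fact
  then show ?thesis by simp
qed

section \<open>The spectral family\<close>

text \<open>The clauses of a spectral family apart from the integral, so that they serve both a
  given family and the one under construction.\<close>

locale projection_family =
  fixes E :: "real \<Rightarrow> 'a::chilbert_space \<Rightarrow> 'a" and lo hi :: real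
  assumes proj: "orth_projection (E t)"
    and absorb: "s \<le> t \<Longrightarrow> E t (E s x) = E s x"
    and right_lim: "((\<lambda>s. E s x) \<longlongrightarrow> E t x) (at_right t)"
    and below: "t < lo \<Longrightarrow> E t x = 0"
    and above: "hi \<le> t \<Longrightarrow> E t x = x"
begin

lemma absorb': "s \<le> t \<Longrightarrow> E s (E t x) = E s x"
  by (rule cinner_eqI) (simp add: absorb flip: orth_projection_sym[OF proj])

lemma commute: "E s (E t x) = E t (E s x)"
  by (cases s t rule: linorder_cases) (simp_all add: absorb absorb')

abbreviation dist_fun :: "'a \<Rightarrow> real \<Rightarrow> real" where
  "dist_fun x t \<equiv> Re (cinner x (E t x))"

lemma dist_fun: "dist_fun x t = (norm (E t x))\<^sup>2"
  by (simp add: cinner_orth_projection[OF proj])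

lemma dist_fun_mono: "s \<le> t \<Longrightarrow> dist_fun x s \<le> dist_fun x t"
  unfolding dist_fun using norm_orth_projection_le[OF proj, of s "E t x"]
  by (intro power_mono) (simp_all add: absorb')

lemma dist_fun_right_cont: "(dist_fun x \<longlongrightarrow> dist_fun x t) (at_right t)"
  by (intro tendsto_Re tendsto_cinner tendsto_const right_lim)

lemma bounded_distribution_dist_fun:
  assumes "E a x = 0" "E b x = x" "a \<le> b"
  shows "bounded_distribution (dist_fun x) a b"
proof
  show "dist_fun x s = 0" if "s \<le> a" for s
    using absorb'[OF that, of x] assms(1) by (simp add: dist_fun bounded_clinear_simps[OF orth_projection_bounded[OF proj]])
  show "dist_fun x s = dist_fun x b" if "b \<le> s" for s
    using absorb[OF that, of x] assms(2) by simp
qed (use dist_fun_mono dist_fun_right_cont assms(3) in \<open>auto simp: continuous_within\<close>)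

lemma is_spectral_familyI:
  assumes "\<And>x. cinner x (X x) = complex_of_real (LINT t|stieltjes E x. t)"
  shows "is_spectral_family X E"
  unfolding is_spectral_family_def
proof (intro conjI allI impI)
  show "\<exists>m M. (\<forall>t<m. E t = (\<lambda>x. 0)) \<and> (\<forall>t\<ge>M. E t = id)"
    by (intro exI[of _ lo] exI[of _ hi]) (auto simp: below above)
qed (auto simp: proj absorb right_lim assms)

end

lemma is_spectral_family_projection_family:
  assumes "is_spectral_family X E"
  obtains lo hi where "projection_family E lo hi"
proof -
  obtain lo hi where "\<forall>t<lo. E t = (\<lambda>x. 0)" "\<forall>t\<ge>hi. E t = id"
    using assms unfolding is_spectral_family_def by blast
  then have "projection_family E lo hi"
    using assms by unfold_locales (auto simp: is_spectral_family_def fun_eq_iff)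
  then show thesis by (rule that)
qed

text \<open>The delicate clause is commutation, as E is linked to X through quadratic forms only. It
  follows from additivity of the form over the range of \<open>E t\<close> and its
  complement.\<close>

lemma is_spectral_family_cut:
  fixes X :: "'a::chilbert_space \<Rightarrow> 'a"
  assumes X: "selfadjoint X" and E: "is_spectral_family X E"
  shows "spectral_cut (\<lambda>x. X x - t *\<^sub>R x) (E t)"
proof -
  obtain lo0 hi0 where fam: "projection_family E lo0 hi0"
    using E by (rule is_spectral_family_projection_family)
  interpret projection_family E lo0 hi0 by (rule fam)
  have form: "Re (cinner x (X x)) = (LINT t|interval_measure (dist_fun x). t)" for x
    using E by (simp add: is_spectral_family_def stieltjes_def)
  \<comment> \<open>E vanishes strictly below lo0, hence the shift by 1. Vectors in the range of
    \<open>E t\<close> have their mass in (lo, t], those in the complement in (t, hi].\<close>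
  define lo hi where "lo = min (lo0 - 1) t" and "hi = max hi0 (t + 1)"
  have bounds: "E lo x = 0" "E hi x = x" "lo \<le> t" "t < hi" for x
    by (auto simp: lo_def hi_def below above)
  note X_lin = bounded_clinear_simps[OF selfadjoint_bounded[OF X]]
  note E_lin = bounded_clinear_simps[OF orth_projection_bounded[OF proj]]
  show ?thesis
    unfolding spectral_cut_def
  proof (intro conjI allI impI)
    show "orth_projection (E t)" by (rule proj)
    show "Re (cinner x (X x - t *\<^sub>R x)) \<le> 0" if x: "E t x = x" for x
    proof -
      interpret bounded_distribution "dist_fun x" lo t
        by (rule bounded_distribution_dist_fun) (simp_all add: bounds x)
      obtain b where "(LINT t|\<mu>. t) = b t - b lo" "b t - b lo \<le> t * (dist_fun x t - dist_fun x lo)"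
        using stieltjes_primitive m_le_M by metis
      then show ?thesis
        by (simp add: form cinner_diff_right x bounds)
    qed
    show "0 < Re (cinner x (X x - t *\<^sub>R x))" if x: "E t x = 0" "x \<noteq> 0" for x
    proof -
      interpret bounded_distribution "dist_fun x" t hi
        by (rule bounded_distribution_dist_fun) (use bounds x in auto)
      obtain b where b: "\<And>s t. s \<le> t \<Longrightarrow> s * (dist_fun x t - dist_fun x s) \<le> b t - b s"
          "(LINT t|\<mu>. t) = b hi - b t"
        using stieltjes_primitive by metis
      \<comment> \<open>Strictness: by right continuity some mass lies beyond a point s > t, where
        the integrand is at least s.\<close>
      have "\<forall>\<^sub>F s in at_right t. dist_fun x s < (norm x)\<^sup>2"
        by (rule order_tendstoD(2)[OF dist_fun_right_cont]) (simp add: x)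
      moreover have "\<forall>\<^sub>F s in at_right t. t < s \<and> s < hi"
        using bounds(4) by (auto simp: eventually_at_right[OF bounds(4)])
      ultimately have "\<forall>\<^sub>F s in at_right t. dist_fun x s < (norm x)\<^sup>2 \<and> t < s \<and> s < hi"
        by eventually_elim simp
      then obtain s where s: "dist_fun x s < (norm x)\<^sup>2" "t < s" "s < hi"
        using eventually_happens'[OF trivial_limit_at_right_real] by blast
      have "t * dist_fun x s \<le> b s - b t" "s * ((norm x)\<^sup>2 - dist_fun x s) \<le> b hi - b s"
        using b(1)[of t s] b(1)[of s hi] s x bounds by simp_all
      moreover have "t * ((norm x)\<^sup>2 - dist_fun x s) < s * ((norm x)\<^sup>2 - dist_fun x s)"
        using s by (intro mult_strict_right_mono) simp_all
      ultimately show ?thesis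
        by (simp add: form cinner_diff_right b(2) algebra_simps)
    qed
    \<comment> \<open>The terms <u, E s v> vanish, so the distribution functions of u and v add up.
      By uniqueness their primitives do too, which removes the real cross term from the form at u +
      v.\<close>
    have ortho: "Re (cinner u (X v)) = 0" if u: "E t u = u" and v: "E t v = 0" for u v
    proof -
      have distr: "bounded_distribution (dist_fun x) lo hi" for x
        by (rule bounded_distribution_dist_fun) (use bounds in auto)
      have prim: "\<exists>b. (\<forall>s t. s \<le> t \<longrightarrow> s * (dist_fun x t - dist_fun x s) \<le> b t - b s \<and>
          b t - b s \<le> t * (dist_fun x t - dist_fun x s)) \<and> Re (cinner x (X x)) = b hi - b lo" for x
      proof -
        interpret bounded_distribution "dist_fun x" lo hi by (rule distr)
        obtain b where "\<And>s t. s \<le> t \<Longrightarrow> s * (dist_fun x t - dist_fun x s) \<le> b t - b s"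
          "\<And>s t. s \<le> t \<Longrightarrow> b t - b s \<le> t * (dist_fun x t - dist_fun x s)"
          "(LINT t|\<mu>. t) = b hi - b lo"
          using stieltjes_primitive by metis
        then show ?thesis
          by (intro exI[of _ b]) (simp add: form)
      qed
      obtain bu where bu: "\<And>s t. s \<le> t \<Longrightarrow> s * (dist_fun u t - dist_fun u s) \<le> bu t - bu s"
          "\<And>s t. s \<le> t \<Longrightarrow> bu t - bu s \<le> t * (dist_fun u t - dist_fun u s)"
          "Re (cinner u (X u)) = bu hi - bu lo"
        using prim[of u] by blast
      obtain bv where bv: "\<And>s t. s \<le> t \<Longrightarrow> s * (dist_fun v t - dist_fun v s) \<le> bv t - bv s"
          "\<And>s t. s \<le> t \<Longrightarrow> bv t - bv s \<le> t * (dist_fun v t - dist_fun v s)"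
          "Re (cinner v (X v)) = bv hi - bv lo"
        using prim[of v] by blast
      obtain b where b: "\<And>s r. s \<le> r \<Longrightarrow> s * (dist_fun (u + v) r - dist_fun (u + v) s) \<le> b r - b s"
          "\<And>s r. s \<le> r \<Longrightarrow> b r - b s \<le> r * (dist_fun (u + v) r - dist_fun (u + v) s)"
          "Re (cinner (u + v) (X (u + v))) = b hi - b lo"
        using prim[of "u + v"] by blast
      have cross: "cinner u (E s v) = 0" for s
        by (metis cinner_zero(2) commute E_lin(4) orth_projection_sym[OF proj] u v)
      have "cinner v (E s u) = 0" for s
        by (metis cross cinner_commute complex_cnj_zero orth_projection_sym[OF proj])
      then have sum: "dist_fun (u + v) s = dist_fun u s + dist_fun v s" for s
        by (simp add: E_lin cinner_simps cross)
      have "b hi - b lo = (bu hi + bv hi) - (bu lo + bv lo)"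
      proof (rule stieltjes_primitive_unique[OF b(1,2), where b="\<lambda>s. bu s + bv s"])
        fix s r :: real assume sr: "s \<le> r"
        show "s * (dist_fun (u + v) r - dist_fun (u + v) s) \<le> (bu r + bv r) - (bu s + bv s)"
          using bu(1)[OF sr] bv(1)[OF sr] by (simp add: sum algebra_simps)
        show "(bu r + bv r) - (bu s + bv s) \<le> r * (dist_fun (u + v) r - dist_fun (u + v) s)"
          using bu(2)[OF sr] bv(2)[OF sr] by (simp add: sum algebra_simps)
      qed (use bounds in simp_all)
      then have "Re (cinner (u + v) (X (u + v))) = Re (cinner u (X u)) + Re (cinner v (X v))"
        by (simp add: b(3) bu(3) bv(3))
      moreover have "Re (cinner v (X u)) = Re (cinner u (X v))"
        by (metis Re_cinner_commute selfadjoint_sym[OF X])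
      ultimately show ?thesis
        by (simp add: X_lin cinner_simps)
    qed
    \<comment> \<open>The residual v is annihilated by \<open>E t\<close>, and |v|^2 is a cross term
      to which \<open>ortho\<close> applies.\<close>
    have "E t (X (E t x)) = X (E t x)" for x
    proof -
      define v where "v = X (E t x) - E t (X (E t x))"
      have Ev: "E t v = 0"
        by (simp add: v_def E_lin absorb)
      have "cinner v v = cinner v (X (E t x)) - cinner (E t v) (X (E t x))"
        by (subst (2) v_def) (simp add: cinner_diff_right orth_projection_sym[OF proj])
      also have "\<dots> = cinner (X v) (E t x)"
        by (simp add: Ev selfadjoint_sym[OF X])
      finally have "(norm v)\<^sup>2 = Re (cinner (E t x) (X v))"
        by (metis Re_cinner_commute Re_cinner_self)
      then have "v = 0"
        using ortho[OF _ Ev, of "E t x"] by (simp add: absorb)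
      then show ?thesis by (simp add: v_def)
    qed
    from orth_projection_commute[OF proj X this]
    show "E t (X x - t *\<^sub>R x) = X (E t x) - t *\<^sub>R E t x" for x
      by (simp add: E_lin)
  qed
qed

text \<open>The distance to the limit shrinks monotonically towards t, so one member of the sequence
  controls a whole right neighbourhood.\<close>

lemma tendsto_at_right_of_seq:
  fixes f :: "real \<Rightarrow> 'a::real_normed_vector"
  assumes seq: "(\<lambda>n. f (t + 1 / real (Suc n))) \<longlonglongrightarrow> l"
    and mono: "\<And>s s'. t < s \<Longrightarrow> s \<le> s' \<Longrightarrow> norm (f s - l) \<le> norm (f s' - l)"
  shows "(f \<longlongrightarrow> l) (at_right t)"
proof (rule tendstoI)
  fix e :: real assume "0 < e"
  then have "\<forall>\<^sub>F n in sequentially. dist (f (t + 1 / real (Suc n))) l < e"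
    using seq by (rule tendstoD[rotated])
  then obtain n where n: "dist (f (t + 1 / real (Suc n))) l < e"
    by (auto simp: eventually_sequentially)
  have "t < t + 1 / real (Suc n)" by simp
  then show "\<forall>\<^sub>F s in at_right t. dist (f s) l < e"
    unfolding eventually_at_right[OF \<open>t < t + 1 / real (Suc n)\<close>]
  proof (intro exI conjI allI impI)
    fix s assume "t < s" "s < t + 1 / real (Suc n)"
    then show "dist (f s) l < e"
      using mono[of s "t + 1 / real (Suc n)"] n by (simp add: dist_norm)
  qed
qed

lemma spectral_family_exists:
  fixes X :: "'a::chilbert_space \<Rightarrow> 'a"
  assumes X: "selfadjoint X"
  obtains E where "is_spectral_family X E"
proof -
  note X_lin = bounded_clinear_simps[OF selfadjoint_bounded[OF X]]
  have shift: "selfadjoint (\<lambda>x. X x - t *\<^sub>R x)" for t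
    by (intro selfadjoint_diff X selfadjoint_scaleR selfadjoint_id)
  have "\<exists>P. spectral_cut (\<lambda>x. X x - t *\<^sub>R x) P \<and>
      (\<forall>C. selfadjoint C \<longrightarrow> (\<forall>x. C (X x) = X (C x)) \<longrightarrow> (\<forall>x. P (C x) = C (P x)))" for t
  proof -
    obtain P where P: "spectral_cut (\<lambda>x. X x - t *\<^sub>R x) P" "\<forall>C. selfadjoint C \<longrightarrow>
        (\<forall>x. C (X x - t *\<^sub>R x) = X (C x) - t *\<^sub>R C x) \<longrightarrow> (\<forall>x. P (C x) = C (P x))"
      by (rule spectral_cut_exists[OF shift])
    have "C (X x - t *\<^sub>R x) = X (C x) - t *\<^sub>R C x" if "selfadjoint C" "\<forall>x. C (X x) = X (C x)" for C x
      using that by (simp add: bounded_clinear_simps[OF selfadjoint_bounded])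
    with P show ?thesis by blast
  qed
  then obtain E where cut: "\<And>t. spectral_cut (\<lambda>x. X x - t *\<^sub>R x) (E t)"
    and E_comm: "\<And>t C x. selfadjoint C \<Longrightarrow> (\<forall>x. C (X x) = X (C x)) \<Longrightarrow> E t (C x) = C (E t x)"
    by metis
  note proj = spectral_cutD(1)[OF cut]
  note E_lin = bounded_clinear_simps[OF orth_projection_bounded[OF proj]]
  have E_sa: "selfadjoint (E t)" for t
    using proj by (simp add: orth_projection_def)
  have EX: "E t (X x) = X (E t x)" for t x
    by (rule E_comm[OF X]) simp
  have EE: "E t (E s x) = E s (E t x)" for s t x
    by (rule E_comm[OF E_sa]) (simp add: EX)
  have below_t: "Re (cinner x (X x)) \<le> t * (norm x)\<^sup>2" if "E t x = x" for t x
    using spectral_cutD(3)[OF cut that] by (simp add: cinner_diff_right)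
  have above_t: "t * (norm x)\<^sup>2 < Re (cinner x (X x))" if "E t x = 0" "x \<noteq> 0" for t x
    using spectral_cutD(4)[OF cut that] by (simp add: cinner_diff_right)
  have above_t': "t * (norm x)\<^sup>2 \<le> Re (cinner x (X x))" if "E t x = 0" for t x
    using above_t[OF that] by (cases "x = 0") auto
  have absorb: "E t (E s x) = E s x" if "s \<le> t" for s t x
  proof (rule ccontr)
    assume ne: "E t (E s x) \<noteq> E s x"
    \<comment> \<open>z lies in the range of \<open>E s\<close> and in the kernel of
      \<open>E t\<close>, so its form would be above t |z|^2 and at most s |z|^2.\<close>
    define z where "z = E s x - E t (E s x)"
    have "E s z = z" "E t z = 0"
      using EE[of t s] by (simp_all add: z_def E_lin orth_projection_idem[OF proj])
    moreover have "z \<noteq> 0" using ne by (simp add: z_def)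
    ultimately have "t * (norm z)\<^sup>2 < s * (norm z)\<^sup>2"
      using below_t above_t order.strict_trans2 by blast
    then show False
      using that by (simp add: mult_less_cancel_right)
  qed
  have absorb': "E s (E t x) = E s x" if "s \<le> t" for s t x
    using absorb[OF that] EE[of s t] by simp
  obtain K where K: "0 < K" "\<And>x. norm (X x) \<le> K * norm x"
    using bounded_clinear_bound[OF selfadjoint_bounded[OF X]] by blast
  have form_le: "\<bar>Re (cinner x (X x))\<bar> \<le> K * (norm x)\<^sup>2" for x
  proof -
    have "\<bar>Re (cinner x (X x))\<bar> \<le> norm x * norm (X x)"
      using abs_Re_le_cmod Cauchy_Schwarz order_trans by blast
    also have "\<dots> \<le> norm x * (K * norm x)"
      using K by (intro mult_left_mono) auto
    finally show ?thesis by (simp add: power2_eq_square mult_ac)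
  qed
  have below: "E t x = 0" if "t < - K" for t x
  proof (rule ccontr)
    assume ne: "E t x \<noteq> 0"
    have "- K * (norm (E t x))\<^sup>2 \<le> t * (norm (E t x))\<^sup>2"
      using below_t[of t "E t x"] form_le[of "E t x"] by (simp add: orth_projection_idem[OF proj])
    then have "- K \<le> t"
      by (rule mult_right_le_imp_le) (simp add: ne)
    then show False
      using that by simp
  qed
  have above: "E t x = x" if "K \<le> t" for t x
  proof (rule ccontr)
    assume "E t x \<noteq> x"
    then have ne: "x - E t x \<noteq> 0" by simp
    have "t * (norm (x - E t x))\<^sup>2 < K * (norm (x - E t x))\<^sup>2"
      using above_t[OF _ ne, of t] form_le[of "x - E t x"] by (simp add: E_lin orth_projection_idem[OF proj])
    then show False
      using that by (simp add: mult_less_cancel_right)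
  qed
  have right_lim: "((\<lambda>s. E s x) \<longlongrightarrow> E t x) (at_right t)" for t x
  proof (rule tendsto_at_right_of_seq)
    define r where "r n = t + 1 / real (Suc n)" for n
    have r: "t \<le> r n" "n \<le> m \<Longrightarrow> r m \<le> r n" for m n
      by (simp_all add: r_def frac_le)
    have r_lim: "r \<longlonglongrightarrow> t"
      unfolding r_def using tendsto_add[OF tendsto_const LIMSEQ_Suc[OF lim_1_over_n], of t] by simp
    \<comment> \<open>The limit z is fixed by every \<open>E (r n)\<close>, so its form is at most t
      |z|^2, whereas \<open>E t z = 0\<close> demands the strict opposite unless z = 0.\<close>
    obtain z where z: "(\<lambda>n. E (r n) x - E t x) \<longlonglongrightarrow> z" "\<And>n. E (r n) z - E t z = z"
    proof (rule decreasing_orth_projections_converge[where D="\<lambda>n x. E (r n) x - E t x" and x=x])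
      show "orth_projection (\<lambda>x. E (r n) x - E t x)" for n
        by (rule orth_projectionI)
          (simp_all add: selfadjoint_diff E_sa E_lin absorb[OF r(1)] absorb'[OF r(1)]
            orth_projection_idem[OF proj])
      show "E (r n) (E (r m) x - E t x) - E t (E (r m) x - E t x) = E (r m) x - E t x"
        if "n \<le> m" for m n x
        by (simp add: E_lin absorb[OF r(1)] absorb'[OF r(1)] absorb[OF r(2)[OF that]]
            orth_projection_idem[OF proj])
    qed blast
    have Erz: "E (r n) z = z" for n
      by (metis z(2) E_lin(2) orth_projection_idem[OF proj] absorb[OF r(1)])
    have Etz: "E t z = 0"
      using z(2)[of 0] Erz[of 0] by simp
    have "Re (cinner z (X z)) \<le> t * (norm z)\<^sup>2"
      by (rule LIMSEQ_le_const[OF tendsto_mult_right[OF r_lim]]) (use below_t[OF Erz] in blast)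
    then have "z = 0"
      using above_t[OF Etz] by fastforce
    then show "(\<lambda>n. E (t + 1 / real (Suc n)) x) \<longlonglongrightarrow> E t x"
      using z(1) by (simp add: LIM_zero_iff r_def)
    show "norm (E s x - E t x) \<le> norm (E s' x - E t x)" if "t < s" "s \<le> s'" for s s'
      using norm_orth_projection_le[OF proj, of s "E s' x - E t x"] that
      by (simp add: E_lin absorb absorb')
  qed
  interpret projection_family E "- K" K
    by unfold_locales (fact proj absorb right_lim below above)+
  have "is_spectral_family X E"
  proof (rule is_spectral_familyI)
    fix x
    \<comment> \<open>\<open>below\<close> is strict at - K, hence the shifted lower end
      point.\<close>
    have "E (- K - 1) x = 0" "E K x = x"
      using below above by simp_all
    then interpret bounded_distribution "dist_fun x" "- K - 1" K
      using K(1) by (intro bounded_distribution_dist_fun) auto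
    obtain b where b: "\<And>s t. s \<le> t \<Longrightarrow> s * (dist_fun x t - dist_fun x s) \<le> b t - b s"
        "\<And>s t. s \<le> t \<Longrightarrow> b t - b s \<le> t * (dist_fun x t - dist_fun x s)"
        "(LINT t|\<mu>. t) = b K - b (- K - 1)"
      using stieltjes_primitive by metis
    \<comment> \<open>The candidate primitive: its increments are forms of X on the range of
      \<open>E t - E s\<close>, where X lies between s and t.\<close>
    define a where "a t = Re (cinner x (X (E t x)))" for t
    have diff: "a t - a s = Re (cinner (E t x - E s x) (X (E t x - E s x)))" if "s \<le> t" for s t
    proof -
      have "E t (E t x - E s x) - E s (E t x - E s x) = E t x - E s x"
        using that by (simp add: E_lin absorb absorb' orth_projection_idem[OF proj])
      then have "cinner x (X (E t x - E s x)) = cinner x (X (E t (E t x - E s x) - E s (E t x - E s x)))"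
        by simp
      also have "\<dots> = cinner (E t x - E s x) (X (E t x - E s x))"
        by (simp add: X_lin(2) E_lin(2) cinner_simps orth_projection_sym[OF proj] flip: EX)
      finally have "Re (cinner x (X (E t x - E s x))) = Re (cinner (E t x - E s x) (X (E t x - E s x)))"
        by (rule arg_cong)
      then show ?thesis
        by (simp only: a_def X_lin(2) cinner_diff_right minus_complex.sel)
    qed
    have nrm: "dist_fun x t - dist_fun x s = (norm (E t x - E s x))\<^sup>2" if "s \<le> t" for s t
      using norm_orth_projection_split[OF proj, of "E t x" s] that by (simp add: dist_fun absorb')
    have "a K - a (- K - 1) = b K - b (- K - 1)"
    proof (rule stieltjes_primitive_unique[OF _ _ b(1,2)])
      show "s * (dist_fun x t - dist_fun x s) \<le> a t - a s" if "s \<le> t" for s t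
        unfolding diff[OF that] nrm[OF that]
        by (rule above_t') (use that in \<open>simp add: E_lin absorb' orth_projection_idem[OF proj]\<close>)
      show "a t - a s \<le> t * (dist_fun x t - dist_fun x s)" if "s \<le> t" for s t
        unfolding diff[OF that] nrm[OF that]
        by (rule below_t) (use that in \<open>simp add: E_lin absorb orth_projection_idem[OF proj]\<close>)
    qed (use K(1) in simp_all)
    then have "(LINT t|\<mu>. t) = Re (cinner x (X x))"
      using b(3) by (simp add: a_def above below X_lin)
    then show "cinner x (X x) = complex_of_real (LINT t|stieltjes E x. t)"
      using selfadjoint_cinner_real[OF X, of x] by (simp add: stieltjes_def)
  qed
  then show thesis by (rule that)
qed

lemma is_spectral_family_spectral_family:
  assumes X: "selfadjoint X"
  shows "is_spectral_family X (spectral_family X)"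
  unfolding spectral_family_def
proof (rule theI'[of "is_spectral_family X"])
  have shift: "selfadjoint (\<lambda>x. X x - t *\<^sub>R x)" for t
    by (intro selfadjoint_diff X selfadjoint_scaleR selfadjoint_id)
  obtain E where E: "is_spectral_family X E"
    by (rule spectral_family_exists[OF X])
  show "\<exists>!E. is_spectral_family X E"
  proof (rule ex1I[of _ E])
    show "is_spectral_family X E" by (rule E)
    show "E' = E" if "is_spectral_family X E'" for E'
      using spectral_cut_unique[OF shift is_spectral_family_cut[OF X that] is_spectral_family_cut[OF X E]]
      by (rule ext)
  qed
qed

section \<open>Spectral integrals, the negative spectral projection and the sign\<close>

lemma spectral_integral_eqI:
  assumes "bounded_clinear B"
    "\<And>x. cinner x (B x) = complex_of_real (LINT t|stieltjes (spectral_family X) x. f t)"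
  shows "spectral_integral X f = B"
  unfolding spectral_integral_def
proof (rule the_equality)
  show "B' = B" if "bounded_clinear B' \<and>
      (\<forall>x. cinner x (B' x) = complex_of_real (LINT t|stieltjes (spectral_family X) x. f t))" for B'
    using that assms by (intro polarization_eq) simp_all
qed (use assms in simp)

text \<open>The projection onto the spectral subspace for \<open>(-\<infinity>, 0)\<close>.\<close>

definition neg_projection :: "('a::complex_inner \<Rightarrow> 'a) \<Rightarrow> ('a \<Rightarrow> 'a) \<Rightarrow> bool" where
  "neg_projection X N \<longleftrightarrow> spectral_cut (\<lambda>x. - X x) (\<lambda>x. x - N x)"

text \<open>Cutting - X instead of X assigns the kernel of X to the nonnegative side, in agreement
  with sign(0) = 1 and with the open interval in \<open>nu_minus\<close>.\<close>

lemma neg_projectionD: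
  assumes X: "selfadjoint X" and "neg_projection X N"
  shows "orth_projection N" "N (X x) = X (N x)"
    "N x = 0 \<Longrightarrow> 0 \<le> Re (cinner x (X x))"
    "N x = x \<Longrightarrow> x \<noteq> 0 \<Longrightarrow> Re (cinner x (X x)) < 0"
proof -
  note cut = assms(2)[unfolded neg_projection_def]
  show N: "orth_projection N"
    using orth_projection_compl[OF spectral_cutD(1)[OF cut]] by simp
  show "N (X x) = X (N x)"
    using spectral_cutD(2)[OF cut, of x]
    by (simp add: bounded_clinear_simps[OF orth_projection_bounded[OF N]]
        bounded_clinear_simps[OF selfadjoint_bounded[OF X]])
  show "N x = 0 \<Longrightarrow> 0 \<le> Re (cinner x (X x))"
    using spectral_cutD(3)[OF cut, of x] by simp
  show "N x = x \<Longrightarrow> x \<noteq> 0 \<Longrightarrow> Re (cinner x (X x)) < 0"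
    using spectral_cutD(4)[OF cut, of x] by simp
qed

lemma neg_projection_abs:
  fixes X :: "'a::chilbert_space \<Rightarrow> 'a"
  assumes X: "selfadjoint X" and N: "neg_projection X N"
  shows "op_abs X x = X x - 2 *\<^sub>R N (X x)"
proof -
  have mX: "selfadjoint (\<lambda>x. - X x)"
    using selfadjoint_scaleR[OF X, of "-1"] by simp
  have "op_abs X x = op_abs (\<lambda>x. - X x) x"
    by (simp add: op_abs_def comp_def bounded_clinear_simps[OF selfadjoint_bounded[OF X]])
  also have "\<dots> = - X x - 2 *\<^sub>R (- X x - N (- X x))"
    using spectral_cut_abs[OF mX N[unfolded neg_projection_def]] by simp
  also have "\<dots> = X x - 2 *\<^sub>R N (X x)"
    using scaleR_2[of "X x"]
    by (simp add: bounded_clinear_simps[OF orth_projection_bounded[OF neg_projectionD(1)[OF X N]]]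
        algebra_simps)
  finally show ?thesis .
qed

text \<open>N is the left limit of E at 0. The projections N - E (- 1 / Suc n) decrease to a limit
  fixed by N whose form is at least - |z|^2 / Suc n for all n, hence nonnegative; on the range of N
  this forces z = 0.\<close>

lemma neg_projection_distribution:
  fixes X :: "'a::chilbert_space \<Rightarrow> 'a"
  assumes X: "selfadjoint X" and E: "is_spectral_family X E"
  obtains N where "neg_projection X N"
    "\<And>x. (\<lambda>n. Re (cinner x (E (0 - 1 / real (Suc n)) x))) \<longlonglongrightarrow> Re (cinner x (N x))"
proof -
  obtain lo hi where fam: "projection_family E lo hi"
    using E by (rule is_spectral_family_projection_family)
  interpret projection_family E lo hi by (rule fam)
  note E_lin = bounded_clinear_simps[OF orth_projection_bounded[OF proj]]
  note E_idem = orth_projection_idem[OF proj]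
  have E_sa: "selfadjoint (E t)" for t
    using proj by (simp add: orth_projection_def)
  note cut = is_spectral_family_cut[OF X E]
  have EX: "E t (X x) = X (E t x)" for t x
    using spectral_cutD(2)[OF cut, of t x] by (simp add: E_lin)
  have mX: "selfadjoint (\<lambda>x. - X x)"
    using selfadjoint_scaleR[OF X, of "-1"] by simp
  obtain Q where Q: "spectral_cut (\<lambda>x. - X x) Q" "\<forall>C. selfadjoint C \<longrightarrow>
      (\<forall>x. C (- X x) = - X (C x)) \<longrightarrow> (\<forall>x. Q (C x) = C (Q x))"
    by (rule spectral_cut_exists[OF mX])
  have QE: "Q (E t x) = E t (Q x)" for t x
    using Q(2) E_sa EX by (simp add: E_lin)
  define N where "N = (\<lambda>x. x - Q x)"
  have neg: "neg_projection X N"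
    using Q(1) by (simp add: neg_projection_def N_def)
  note N = neg_projectionD[OF X neg]
  note N_lin = bounded_clinear_simps[OF orth_projection_bounded[OF N(1)]]
  have N_sa: "selfadjoint N"
    using N(1) by (simp add: orth_projection_def)
  have NE: "N (E t x) = E t x" if "t < 0" for t x
  proof (rule ccontr)
    assume ne: "N (E t x) \<noteq> E t x"
    define z where "z = E t x - N (E t x)"
    have z: "E t z = z" "N z = 0" "z \<noteq> 0"
      using ne by (auto simp: z_def E_lin N_lin E_idem orth_projection_idem[OF N(1)] N_def QE
          orth_projection_idem[OF spectral_cutD(1)[OF Q(1)]])
    have "Re (cinner z (X z)) \<le> t * (norm z)\<^sup>2"
      using spectral_cutD(3)[OF cut z(1)] by (simp add: cinner_diff_right)
    also have "\<dots> < 0"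
      using that z(3) by (simp add: mult_neg_pos)
    finally show False
      using N(3)[OF z(2)] by simp
  qed
  have EN: "E t (N x) = E t x" if "t < 0" for t x
    using NE[OF that, of x] by (simp add: N_def E_lin QE)
  define r where "r n = 0 - 1 / real (Suc n)" for n
  have r: "r n < 0" "n \<le> m \<Longrightarrow> r n \<le> r m" for m n
    by (simp_all add: r_def frac_le)
  have r_lim: "r \<longlonglongrightarrow> 0"
    unfolding r_def using tendsto_diff[OF tendsto_const LIMSEQ_Suc[OF lim_1_over_n], of 0] by simp
  have lim: "(\<lambda>n. N x - E (r n) x) \<longlonglongrightarrow> 0" for x
  proof -
    obtain z where z: "(\<lambda>n. N x - E (r n) x) \<longlonglongrightarrow> z" "\<And>n. N z - E (r n) z = z"
    proof (rule decreasing_orth_projections_converge[where D="\<lambda>n x. N x - E (r n) x" and x=x])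
      show "orth_projection (\<lambda>x. N x - E (r n) x)" for n
        by (rule orth_projectionI)
          (simp_all add: selfadjoint_diff E_sa N_sa E_lin N_lin NE EN r E_idem orth_projection_idem[OF N(1)])
      show "N (N x - E (r m) x) - E (r n) (N x - E (r m) x) = N x - E (r m) x"
        if "n \<le> m" for m n x
        by (simp add: E_lin N_lin NE EN r absorb'[OF r(2)[OF that]] orth_projection_idem[OF N(1)])
    qed blast
    have Nz: "N z = z"
      using z(2)[of 0] by (metis N_lin(2) NE orth_projection_idem[OF N(1)] r(1))
    have Ez: "E (r n) z = 0" for n
      using z(2)[of n] Nz by simp
    have "r n * (norm z)\<^sup>2 \<le> Re (cinner z (X z))" for n
      using spectral_cutD(4)[OF cut Ez] by (cases "z = 0") (auto simp: cinner_diff_right less_imp_le)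
    then have "0 * (norm z)\<^sup>2 \<le> Re (cinner z (X z))"
      by (intro LIMSEQ_le_const2[OF tendsto_mult_right[OF r_lim]]) auto
    then have "z = 0"
      using N(4)[OF Nz] by fastforce
    with z(1) show ?thesis by simp
  qed
  show thesis
  proof (rule that[OF neg])
    fix x
    have "(\<lambda>n. E (r n) x) \<longlonglongrightarrow> N x"
      using tendsto_diff[OF tendsto_const lim, of "N x" x] by simp
    then show "(\<lambda>n. Re (cinner x (E (0 - 1 / real (Suc n)) x))) \<longlonglongrightarrow> Re (cinner x (N x))"
      unfolding r_def by (intro tendsto_Re tendsto_cinner tendsto_const)
  qed
qed

lemma spectral_integral_neg:
  fixes X :: "'a::chilbert_space \<Rightarrow> 'a"
  assumes X: "selfadjoint X"
  obtains N where "neg_projection X N" "spectral_subspace X {..<0} = range N"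
    "op_sign X = (\<lambda>x. x - 2 *\<^sub>R N x)"
proof -
  define E where "E = spectral_family X"
  have E: "is_spectral_family X E"
    unfolding E_def by (rule is_spectral_family_spectral_family[OF X])
  obtain N where neg: "neg_projection X N" and
    lim: "\<And>x. (\<lambda>n. Re (cinner x (E (0 - 1 / real (Suc n)) x))) \<longlonglongrightarrow> Re (cinner x (N x))"
    using neg_projection_distribution[OF X E] by metis
  note N = neg_projectionD[OF X neg]
  have N_sa: "selfadjoint N"
    using N(1) by (simp add: orth_projection_def)
  obtain lo0 hi0 where fam: "projection_family E lo0 hi0"
    using E by (rule is_spectral_family_projection_family)
  interpret projection_family E lo0 hi0 by (rule fam)
  \<comment> \<open>No order between lo0 and hi0 is given, hence the minimum; the 1 moves the end
    point strictly below lo0.\<close>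
  define lo hi where "lo = min lo0 hi0 - 1" and "hi = hi0"
  have distr: "bounded_distribution (dist_fun x) lo hi" for x
    by (rule bounded_distribution_dist_fun) (simp_all add: lo_def hi_def below above)
  have E_hi: "E hi x = x" for x
    by (simp add: hi_def above)
  have meas: "measure (stieltjes E x) {..<0} = Re (cinner x (N x))" for x
    using LIMSEQ_unique[OF bounded_distribution.tendsto_measure_lessThan[OF distr, of x 0] lim]
    by (simp add: stieltjes_def)
  have ind: "spectral_integral X (indicator {..<0}) = N"
  proof (rule spectral_integral_eqI)
    show "bounded_clinear N"
      by (rule selfadjoint_bounded[OF N_sa])
    fix x
    have "(LINT t|stieltjes E x. indicator {..<0} t) = Re (cinner x (N x))"
      using meas[of x] by (simp add: stieltjes_def)
    then show "cinner x (N x) = complex_of_real (LINT t|stieltjes (spectral_family X) x. indicator {..<0} t)"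
      using selfadjoint_cinner_real[OF N_sa, of x] by (simp add: E_def)
  qed
  have sgn: "op_sign X = (\<lambda>x. x - 2 *\<^sub>R N x)"
    unfolding op_sign_def
  proof (rule spectral_integral_eqI)
    have sa: "selfadjoint (\<lambda>x. x - 2 *\<^sub>R N x)"
      by (intro selfadjoint_diff selfadjoint_scaleR N_sa selfadjoint_id)
    then show "bounded_clinear (\<lambda>x. x - 2 *\<^sub>R N x)"
      by (rule selfadjoint_bounded)
    fix x
    interpret distr: bounded_distribution "dist_fun x" lo hi by (rule distr)
    interpret finite_measure "stieltjes E x"
      unfolding stieltjes_def by (rule distr.finite_measure)
    \<comment> \<open>The sign is 1 minus twice the indicator of the negative half line, and the
      total mass is |x|^2.\<close>
    have "(LINT t|stieltjes E x. (if t \<ge> 0 then 1 else - 1 :: real)) =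
        (LINT t|stieltjes E x. 1 - 2 * indicator {..<0} t)"
      by (intro Bochner_Integration.integral_cong) auto
    also have "\<dots> = measure (stieltjes E x) UNIV - 2 * measure (stieltjes E x) {..<0}"
      by (subst Bochner_Integration.integral_diff)
        (auto simp: stieltjes_def emeasure_finite less_top[symmetric]
          distr.finite_measure finite_measure.emeasure_finite
          finite_measure.integrable_const[OF distr.finite_measure])
    also have "\<dots> = Re (cinner x (x - 2 *\<^sub>R N x))"
      using distr.measure_UNIV by (simp add: meas cinner_diff_right E_hi) (simp add: stieltjes_def)
    finally show "cinner x (x - 2 *\<^sub>R N x) = complex_of_real
        (LINT t|stieltjes (spectral_family X) x. (if t \<ge> 0 then 1 else - 1))"
      using selfadjoint_cinner_real[OF sa, of x] by (simp add: E_def)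
  qed
  show thesis
    by (rule that[OF neg _ sgn]) (simp add: spectral_subspace_def ind)
qed

section \<open>Dimensions of spectral subspaces\<close>

lemma module_span_scaleC: "module.span (scaleC :: complex \<Rightarrow> 'a::complex_inner \<Rightarrow> 'a) = cspan"
  by (simp add: cspan_def)

lemma bounded_clinear_imp_linear: "bounded_clinear f \<Longrightarrow> Vector_Spaces.linear scaleC scaleC f"
  by (simp add: Vector_Spaces.linear_iff complex_vector.vector_space_axioms bounded_clinear_simps)

lemma bounded_clinear_subspace_image:
  "bounded_clinear f \<Longrightarrow> complex_vector.subspace V \<Longrightarrow> complex_vector.subspace (f ` V)"
  by (intro module_hom.subspace_image)
    (auto dest!: bounded_clinear_imp_linear simp: Vector_Spaces.linear_def)

lemma bounded_clinear_span_image: "bounded_clinear f \<Longrightarrow> cspan (f ` B) = f ` cspan B"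
  unfolding module_span_scaleC[symmetric]
  by (intro module_hom.span_image)
    (auto dest!: bounded_clinear_imp_linear simp: Vector_Spaces.linear_def)

lemma bounded_clinear_independent_image:
  assumes f: "bounded_clinear f" and B: "complex_vector.independent B"
    and inj: "\<And>x. x \<in> cspan B \<Longrightarrow> f x = 0 \<Longrightarrow> x = 0"
  shows "complex_vector.independent (f ` B)" "inj_on f (cspan B)"
proof -
  show inj': "inj_on f (cspan B)"
  proof (rule inj_onI)
    show "x = y" if "x \<in> cspan B" "y \<in> cspan B" "f x = f y" for x y
      using inj[of "x - y"] that by (simp add: bounded_clinear_simps[OF f] complex_vector.span_diff)
  qed
  show "complex_vector.independent (f ` B)"
    by (rule module_hom.independent_injective_image[OF _ B])
      (use inj' bounded_clinear_imp_linear[OF f] in \<open>simp_all add: Vector_Spaces.linear_def module_span_scaleC\<close>)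
qed

lemma ecdim_eq_enatE:
  assumes "ecdim V \<noteq> \<infinity>"
  obtains B where "finite B" "B \<subseteq> V" "complex_vector.independent B" "V \<subseteq> cspan B"
    "ecdim V = enat (card B)"
proof -
  have ex: "\<exists>B. finite B \<and> V \<subseteq> cspan B"
    using assms by (auto simp: ecdim_def split: if_splits)
  then obtain B' where B': "finite B'" "V \<subseteq> cspan B'"
    by blast
  have dim: "ecdim V = enat (cdim V)"
    using ex by (simp add: ecdim_def)
  obtain B where B: "B \<subseteq> V" "complex_vector.independent B" "V \<subseteq> cspan B" "card B = cdim V"
    by (rule complex_vector.basis_exists)
  have "finite B"
    using complex_vector.independent_span_bound[OF B'(1) B(2)] B(1) B'(2) by blast
  then show thesis
    by (rule that[OF _ B(1-3)]) (simp add: dim B(4))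
qed

lemma ecdim_eq_card:
  assumes "finite B" "B \<subseteq> V" "complex_vector.independent B" "V \<subseteq> cspan B"
  shows "ecdim V = enat (card B)"
  using assms complex_vector.basis_card_eq_dim[of B V] by (auto simp: ecdim_def)

text \<open>Finiteness of the dimension of V is part of the conclusion: a basis is sent to an
  independent set in the span of a finite set.\<close>

lemma ecdim_le_if_injective:
  assumes f: "bounded_clinear f" and V: "complex_vector.subspace V"
    and inj: "\<And>x. x \<in> V \<Longrightarrow> f x = 0 \<Longrightarrow> x = 0" and sub: "f ` V \<subseteq> W"
  shows "ecdim V \<le> ecdim W"
proof (cases "ecdim W = \<infinity>")
  case False
  then obtain C where C: "finite C" "W \<subseteq> cspan C" "ecdim W = enat (card C)"
    by (rule ecdim_eq_enatE)
  obtain B where B: "B \<subseteq> V" "complex_vector.independent B" "V \<subseteq> cspan B"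
    by (rule complex_vector.basis_exists)
  have span_B: "cspan B \<subseteq> V"
    by (rule complex_vector.span_minimal[OF B(1) V])
  have img: "complex_vector.independent (f ` B)" "inj_on f (cspan B)"
    using bounded_clinear_independent_image[OF f B(2)] inj span_B by blast+
  have "f ` B \<subseteq> cspan C"
    using B(1) sub C(2) by blast
  then have fin: "finite (f ` B)" "card (f ` B) \<le> card C"
    using complex_vector.independent_span_bound[OF C(1) img(1)] by auto
  have "inj_on f B"
    using img(2) complex_vector.span_superset by (rule inj_on_subset)
  then have "finite B" "card B \<le> card C"
    using fin finite_image_iff card_image by metis+
  then show ?thesis
    using ecdim_eq_card[OF _ B] C(3) by simp
qed simp

lemma ecdim_eq_0_iff:
  assumes "complex_vector.subspace V"
  shows "ecdim V = 0 \<longleftrightarrow> V = {0}"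
proof
  assume "ecdim V = 0"
  then have "ecdim V \<noteq> \<infinity>" by simp
  then obtain B where "finite B" "V \<subseteq> cspan B" "ecdim V = enat (card B)"
    by (rule ecdim_eq_enatE)
  with \<open>ecdim V = 0\<close> have "V \<subseteq> {0}"
    by (simp add: zero_enat_def)
  then show "V = {0}"
    using subspace_simps(1)[OF assms] by blast
next
  assume "V = {0}"
  then show "ecdim V = 0"
    using ecdim_eq_card[of "{}" V] by (simp add: zero_enat_def complex_vector.independent_empty)
qed

lemma bounded_clinear_embeddings:
  "bounded_clinear (\<lambda>x. (x, 0))" "bounded_clinear (\<lambda>y. (0, y))"
  by (auto intro!: bounded_clinearI[where K=1] simp: scaleC_prod_def)

lemma bounded_clinear_fst: "bounded_clinear fst"
  by (rule bounded_clinearI[where K=1]) (auto simp: scaleC_prod_def norm_fst_le)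

lemma bounded_clinear_snd: "bounded_clinear snd"
  by (rule bounded_clinearI[where K=1]) (auto simp: scaleC_prod_def norm_snd_le)

lemma bounded_clinear_Pair:
  "bounded_clinear f \<Longrightarrow> bounded_clinear g \<Longrightarrow> bounded_clinear (\<lambda>x. (f x, g x))"
  by (simp add: bounded_clinear_def scaleC_prod_def bounded_linear_Pair)

lemma subspace_Times:
  assumes V: "complex_vector.subspace V" and W: "complex_vector.subspace W"
  shows "complex_vector.subspace (V \<times> W)"
  by (rule complex_vector.subspaceI)
    (auto simp: scaleC_prod_def subspace_simps[OF V] subspace_simps[OF W] zero_prod_def)

lemma ecdim_Times:
  assumes V: "complex_vector.subspace V" and W: "complex_vector.subspace W"
  shows "ecdim (V \<times> W) = ecdim V + ecdim W"
proof (cases "ecdim V = \<infinity> \<or> ecdim W = \<infinity>")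
  case True
  have "ecdim V \<le> ecdim (V \<times> W)"
    by (rule ecdim_le_if_injective[OF bounded_clinear_embeddings(1) V])
      (auto simp: zero_prod_def subspace_simps[OF W])
  moreover have "ecdim W \<le> ecdim (V \<times> W)"
    by (rule ecdim_le_if_injective[OF bounded_clinear_embeddings(2) W])
      (auto simp: zero_prod_def subspace_simps[OF V])
  ultimately show ?thesis
    using True by auto
next
  case False
  then have "ecdim V \<noteq> \<infinity>" "ecdim W \<noteq> \<infinity>" by simp_all
  obtain B where B: "finite B" "B \<subseteq> V" "complex_vector.independent B" "V \<subseteq> cspan B"
      "ecdim V = enat (card B)"
    by (rule ecdim_eq_enatE[OF \<open>ecdim V \<noteq> \<infinity>\<close>])
  obtain C where C: "finite C" "C \<subseteq> W" "complex_vector.independent C" "W \<subseteq> cspan C"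
      "ecdim W = enat (card C)"
    by (rule ecdim_eq_enatE[OF \<open>ecdim W \<noteq> \<infinity>\<close>])
  define inl :: "'a \<Rightarrow> 'a \<times> 'b" where "inl = (\<lambda>x. (x, 0))"
  define inr :: "'b \<Rightarrow> 'a \<times> 'b" where "inr = (\<lambda>y. (0, y))"
  have lin: "bounded_clinear inl" "bounded_clinear inr"
    unfolding inl_def inr_def by (rule bounded_clinear_embeddings)+
  have inl_B: "complex_vector.independent (inl ` B)"
    by (rule bounded_clinear_independent_image[OF lin(1) B(3)]) (simp add: inl_def zero_prod_def)
  \<comment> \<open>The vectors of C are adjoined one at a time; \<open>snd\<close> annihilates the
    image of B, so a dependence of \<open>inr c\<close> would be a dependence of c on D.\<close>
  have indep: "complex_vector.independent (inl ` B \<union> inr ` D)" if "D \<subseteq> C" "finite D" for D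
    using that(2,1)
  proof induction
    case (insert c D)
    have "c \<notin> cspan D"
    proof
      assume "c \<in> cspan D"
      also have "cspan D \<subseteq> cspan (C - {c})"
        using insert.hyps insert.prems by (intro complex_vector.span_mono) auto
      finally show False
        using C(3) insert.prems by (auto simp: complex_vector.dependent_def)
    qed
    have "inr c \<notin> cspan (inl ` B \<union> inr ` D)"
    proof
      assume "inr c \<in> cspan (inl ` B \<union> inr ` D)"
      then have "snd (inr c) \<in> snd ` cspan (inl ` B \<union> inr ` D)"
        by blast
      also have "\<dots> = cspan (snd ` (inl ` B \<union> inr ` D))"
        by (rule bounded_clinear_span_image[OF bounded_clinear_snd, symmetric])
      also have "\<dots> \<subseteq> cspan (insert 0 D)"
        by (intro complex_vector.span_mono) (auto simp: inl_def inr_def)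
      finally show False
        using \<open>c \<notin> cspan D\<close> by (simp add: inr_def)
    qed
    then have "complex_vector.independent (insert (inr c) (inl ` B \<union> inr ` D))"
      using insert.IH insert.prems by (intro complex_vector.independent_insertI) auto
    then show ?case by simp
  qed (simp add: inl_B)
  have "ecdim (V \<times> W) = enat (card (inl ` B \<union> inr ` C))"
  proof (rule ecdim_eq_card)
    show "finite (inl ` B \<union> inr ` C)"
      using B(1) C(1) by simp
    show "inl ` B \<union> inr ` C \<subseteq> V \<times> W"
      using B(2) C(2) subspace_simps(1)[OF V] subspace_simps(1)[OF W] by (auto simp: inl_def inr_def)
    show "complex_vector.independent (inl ` B \<union> inr ` C)"
      by (rule indep[OF subset_refl C(1)])
    show "V \<times> W \<subseteq> cspan (inl ` B \<union> inr ` C)"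
    proof
      fix p assume "p \<in> V \<times> W"
      then have "inl (fst p) \<in> cspan (inl ` B)" "inr (snd p) \<in> cspan (inr ` C)"
        using B(4) C(4) bounded_clinear_span_image[OF lin(1)] bounded_clinear_span_image[OF lin(2)]
        by auto
      then have "inl (fst p) + inr (snd p) \<in> cspan (inl ` B \<union> inr ` C)"
        by (intro complex_vector.span_add) (use complex_vector.span_mono in blast)+
      then show "p \<in> cspan (inl ` B \<union> inr ` C)"
        by (simp add: inl_def inr_def)
    qed
  qed
  also have "card (inl ` B \<union> inr ` C) = card B + card C"
  proof -
    have "0 \<notin> B"
      using B(3) complex_vector.dependent_zero by blast
    then have "inl ` B \<inter> inr ` C = {}"
      by (auto simp: inl_def inr_def)
    moreover have "inj_on inl B" "inj_on inr C"
      by (auto simp: inl_def inr_def intro: inj_onI)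
    ultimately show ?thesis
      using B(1) C(1) by (simp add: card_Un_disjoint card_image)
  qed
  finally show ?thesis
    by (simp add: B(5) C(5))
qed

lemma subspace_range: "bounded_clinear f \<Longrightarrow> complex_vector.subspace (range f)"
  using bounded_clinear_subspace_image[of f UNIV] by simp

text \<open>Replaces the descriptions behind \<open>nu_minus\<close> and \<open>op_sign\<close> by a
  single projection; the later arguments use only its order properties.\<close>

lemma nu_minus_eq:
  fixes X :: "'a::chilbert_space \<Rightarrow> 'a"
  assumes X: "selfadjoint X"
  obtains N where "neg_projection X N" "nu_minus X = ecdim (range N)"
    "op_sign X = (\<lambda>x. x - 2 *\<^sub>R N x)"
proof -
  obtain N where N: "neg_projection X N" "spectral_subspace X {..<0} = range N"
    "op_sign X = (\<lambda>x. x - 2 *\<^sub>R N x)"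
    by (rule spectral_integral_neg[OF X])
  show thesis
    by (rule that[OF N(1) _ N(3)]) (simp add: nu_minus_def N(2))
qed

lemma nu_minus_eq_0_iff:
  fixes X :: "'a::chilbert_space \<Rightarrow> 'a"
  assumes X: "selfadjoint X"
  shows "nu_minus X = 0 \<longleftrightarrow> nonneg_op X"
proof -
  obtain N where neg: "neg_projection X N" and nu: "nu_minus X = ecdim (range N)"
    by (rule nu_minus_eq[OF X])
  note N = neg_projectionD[OF X neg]
  have "nu_minus X = 0 \<longleftrightarrow> range N = {0}"
    unfolding nu by (intro ecdim_eq_0_iff subspace_range orth_projection_bounded N(1))
  also have "\<dots> \<longleftrightarrow> nonneg_op X"
  proof
    assume "range N = {0}"
    then have "N x = 0" for x by blast
    then show "nonneg_op X"
      using X N(3) by (simp add: nonneg_op_def)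
  next
    assume "nonneg_op X"
    then have "N x = 0" for x
      using N(4)[of "N x"] nonneg_opD(2)[of X "N x"] orth_projection_idem[OF N(1)] by force
    then show "range N = {0}" by auto
  qed
  finally show ?thesis .
qed

section \<open>Generalized inverses and blocks\<close>

lemma subspace_op_ker: "bounded_clinear T \<Longrightarrow> complex_vector.subspace (op_ker T)"
  by (rule complex_vector.subspaceI) (simp_all add: op_ker_def bounded_clinear_simps)

lemma continuous_on_bounded_clinear: "bounded_clinear T \<Longrightarrow> continuous_on A T"
  by (simp add: bounded_clinear_def linear_continuous_on)

lemma closed_op_ker: "bounded_clinear T \<Longrightarrow> closed (op_ker T)"
  unfolding op_ker_def by (intro closed_Collect_eq continuous_on_bounded_clinear) auto

lemma continuous_on_cinner:
  fixes f g :: "'a::topological_space \<Rightarrow> 'b::complex_inner"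
  shows "continuous_on A f \<Longrightarrow> continuous_on A g \<Longrightarrow> continuous_on A (\<lambda>x. cinner (f x) (g x))"
  by (rule bounded_bilinear.continuous_on[OF bounded_bilinear_cinner])

lemma closed_orth_compl: "closed (orth_compl V)"
proof -
  have "orth_compl V = (\<Inter>v\<in>V. {x. cinner v x = 0})"
    by (auto simp: orth_compl_def)
  also have "closed \<dots>"
    by (intro closed_INT ballI closed_Collect_eq continuous_on_cinner continuous_on_const continuous_on_id)
  finally show ?thesis .
qed

lemma subspace_closure:
  assumes V: "complex_vector.subspace V"
  shows "complex_vector.subspace (closure V)"
proof (rule complex_vector.subspaceI)
  show "0 \<in> closure V"
    using subspace_simps(1)[OF V] closure_subset by blast
  fix c x y assume x: "x \<in> closure V"
  then obtain u where u: "\<And>n. u n \<in> V" "u \<longlonglongrightarrow> x"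
    by (auto simp: closure_sequential)
  have "bounded_clinear (\<lambda>x::'a. c *\<^sub>C x)"
    by (rule bounded_clinearI[where K="cmod c"])
      (simp_all add: scaleC_add_right scaleC_scaleC mult.commute norm_scaleC)
  then have "(\<lambda>n. c *\<^sub>C u n) \<longlonglongrightarrow> c *\<^sub>C x"
    by (rule bounded_clinear_tendsto[OF _ u(2)])
  then show "c *\<^sub>C x \<in> closure V"
    unfolding closure_sequential by (intro exI[of _ "\<lambda>n. c *\<^sub>C u n"]) (simp add: u subspace_simps[OF V])
  assume "y \<in> closure V"
  then obtain v where v: "\<And>n. v n \<in> V" "v \<longlonglongrightarrow> y"
    by (auto simp: closure_sequential)
  show "x + y \<in> closure V"
    unfolding closure_sequential
    by (intro exI[of _ "\<lambda>n. u n + v n"]) (simp add: u v subspace_simps[OF V] tendsto_add)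
qed

text \<open>The defect d = x - P x is orthogonal to the range of R, so R d = 0 and x is orthogonal
  to d. Norms on this complement can thus be tested against the range of R.\<close>

lemma orth_compl_op_ker_subset:
  fixes R :: "'a::chilbert_space \<Rightarrow> 'a"
  assumes R: "selfadjoint R"
  shows "orth_compl (op_ker R) \<subseteq> closure (range R)"
proof
  fix x assume x: "x \<in> orth_compl (op_ker R)"
  have "complex_vector.subspace (closure (range R))"
    by (intro subspace_closure subspace_range selfadjoint_bounded R)
  then obtain P where P: "orth_projection P" "range P = closure (range R)"
    by (rule orth_projection_onto) simp
  note P_lin = bounded_clinear_simps[OF orth_projection_bounded[OF P(1)]]
  have PR: "P (R u) = R u" for u
    using P(2) closure_subset orth_projection_idem[OF P(1)] by (metis imageE rangeI subsetD)
  define d where "d = x - P x"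
  have Pd: "P d = 0"
    by (simp add: d_def P_lin orth_projection_idem[OF P(1)])
  have "cinner (R u) d = 0" for u
    by (metis PR Pd cinner_zero(2) orth_projection_sym[OF P(1)])
  then have "R d = 0"
    by (intro cinner_eqI) (simp flip: selfadjoint_sym[OF R])
  have "P x \<in> closure (range R)"
    using P(2) by blast
  moreover have "closure (range R) \<subseteq> orth_compl (op_ker R)"
    by (rule closure_minimal[OF _ closed_orth_compl])
      (auto simp: orth_compl_def op_ker_def simp flip: selfadjoint_sym[OF R])
  ultimately have "cinner d (P x) = 0"
    using \<open>R d = 0\<close> by (auto simp: orth_compl_def op_ker_def)
  moreover have "cinner d x = 0"
    using x \<open>R d = 0\<close> by (auto simp: orth_compl_def op_ker_def)
  ultimately have "cinner d d = 0"
    by (subst (2) d_def) (simp add: cinner_diff_right)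
  then have "x = P x"
    by (simp add: d_def)
  then show "x \<in> closure (range R)"
    using P(2) by blast
qed

text \<open>|X| = (1 - 2 N) X commutes with N, hence so does its root. The kernels agree because 1 -
  2 N is injective.\<close>

lemma abs_root:
  fixes X :: "'a::chilbert_space \<Rightarrow> 'a"
  assumes X: "selfadjoint X" and neg: "neg_projection X N"
  defines "R \<equiv> op_sqrt (op_abs X)"
  shows "nonneg_op R" "R (R x) = X x - 2 *\<^sub>R N (X x)" "N (R x) = R (N x)" "R x = 0 \<longleftrightarrow> X x = 0"
proof -
  note N = neg_projectionD[OF X neg]
  note N_lin = bounded_clinear_simps[OF orth_projection_bounded[OF N(1)]]
  note abs = neg_projection_abs[OF X neg]
  note R = op_sqrt[OF op_abs(1)[OF X], folded R_def]
  show R_nn: "nonneg_op R" by (rule R(1))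
  show RR: "R (R x) = X x - 2 *\<^sub>R N (X x)" for x
    by (simp add: R(2) abs)
  show "N (R x) = R (N x)"
    by (rule R(3)[of N, OF orth_projection_bounded[OF N(1)]]) (simp add: abs N_lin N(2))
  show "R x = 0 \<longleftrightarrow> X x = 0"
  proof
    assume "X x = 0"
    then have "R (R x) = 0"
      by (simp add: RR N_lin)
    then have "cinner (R x) (R x) = 0"
      by (simp add: selfadjoint_sym[OF nonneg_opD(1)[OF R_nn]])
    then show "R x = 0" by simp
  next
    assume "R x = 0"
    then have *: "X x - 2 *\<^sub>R N (X x) = 0"
      using RR[of x] by (simp add: bounded_clinear_simps[OF selfadjoint_bounded[OF nonneg_opD(1)[OF R_nn]]])
    then have "N (X x - 2 *\<^sub>R N (X x)) = 0"
      by (simp only: N_lin(4))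
    then have "N (X x) = 0"
      by (simp add: N_lin orth_projection_idem[OF N(1)] scaleR_2)
    with * show "X x = 0" by simp
  qed
qed

lemma abs_inv_sqrt:
  fixes X :: "'a::chilbert_space \<Rightarrow> 'a"
  assumes X: "selfadjoint X" and y: "y \<in> range (op_sqrt (op_abs X))"
  shows "abs_inv_sqrt X y \<in> orth_compl (op_ker X)" "op_sqrt (op_abs X) (abs_inv_sqrt X y) = y"
proof -
  define R where "R = op_sqrt (op_abs X)"
  obtain N where neg: "neg_projection X N"
    by (rule nu_minus_eq[OF X])
  note R = abs_root[OF X neg, folded R_def]
  note R_sa = nonneg_opD(1)[OF R(1)]
  note R_lin = bounded_clinear_simps[OF selfadjoint_bounded[OF R_sa]]
  note X_lin = bounded_clinear_simps[OF selfadjoint_bounded[OF X]]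
  obtain P where P: "orth_projection P" "range P = op_ker X"
    by (rule orth_projection_onto[OF subspace_op_ker[OF selfadjoint_bounded[OF X]]
          closed_op_ker[OF selfadjoint_bounded[OF X]]])
  obtain x0 where x0: "y = R x0"
    using y by (auto simp: R_def)
  \<comment> \<open>Removing the component in ker X = ker R does not change the image under
    R.\<close>
  define x where "x = x0 - P x0"
  have "R (P x0) = 0"
    using P(2) by (auto simp: R(4) op_ker_def)
  then have Rx: "R x = y"
    by (simp add: x_def R_lin x0)
  have x: "x \<in> orth_compl (op_ker X)"
  proof -
    have "cinner (P v) x = 0" for v
      by (simp add: x_def orth_projection_sym[OF P(1)] orth_projection_idem[OF P(1)]
          bounded_clinear_simps[OF orth_projection_bounded[OF P(1)]])
    then show ?thesis
      unfolding orth_compl_def P(2)[symmetric] by blast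
  qed
  have "abs_inv_sqrt X y = x"
    unfolding abs_inv_sqrt_def R_def[symmetric]
  proof (rule the_equality)
    have "0 \<in> op_ker X" by (simp add: op_ker_def X_lin)
    then show "x \<in> orth_compl (op_ker X) \<and> (\<exists>z\<in>op_ker X. y = R x + z)"
      using x Rx by (intro conjI bexI[of _ 0]) simp_all
    fix x' assume x': "x' \<in> orth_compl (op_ker X) \<and> (\<exists>z\<in>op_ker X. y = R x' + z)"
    then obtain z where z: "X z = 0" "y = R x' + z"
      by (auto simp: op_ker_def)
    define d where "d = x - x'"
    \<comment> \<open>z lies in the range and in the kernel of the selfadjoint R, so it is 0; the
      kernel summand allowed by the description leaves no ambiguity.\<close>
    have "R d = z"
      using z(2) Rx by (simp add: d_def R_lin)
    then have "R (R d) = 0"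
      using z(1) by (simp add: R(4))
    then have "cinner (R d) (R d) = 0"
      by (simp add: selfadjoint_sym[OF R_sa])
    then have "d \<in> op_ker X"
      by (simp add: R(4) op_ker_def)
    then have "cinner d x = 0" "cinner d x' = 0"
      using x x' by (auto simp: orth_compl_def)
    then have "cinner d d = 0"
      by (subst (2) d_def) (simp add: cinner_diff_right)
    then show "x' = x" by (simp add: d_def)
  qed
  with x Rx show "abs_inv_sqrt X y \<in> orth_compl (op_ker X)" "op_sqrt (op_abs X) (abs_inv_sqrt X y) = y"
    by (simp_all add: R_def)
qed

text \<open>The sets of \<open>y\<close> with \<open>|\<langle>B y, x\<rangle>| \<le> n \<parallel>R x\<parallel>\<close> for all \<open>x\<close> are closed and cover the space, so
  Baire's theorem makes one of them a neighbourhood of some point.\<close>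

lemma bounded_clinear_factor:
  fixes R :: "'a::chilbert_space \<Rightarrow> 'a" and B S :: "'b::chilbert_space \<Rightarrow> 'a"
  assumes R: "selfadjoint R" and B: "bounded_clinear B"
    and RS: "\<And>y. R (S y) = B y" and S: "\<And>y. S y \<in> orth_compl (op_ker R)"
  shows "bounded_clinear S"
proof -
  note R_lin = bounded_clinear_simps[OF selfadjoint_bounded[OF R]]
  note B_lin = bounded_clinear_simps[OF B]
  have uniq: "u = v" if "u \<in> orth_compl (op_ker R)" "v \<in> orth_compl (op_ker R)" "R u = R v" for u v
  proof -
    have "u - v \<in> op_ker R"
      using that(3) by (simp add: op_ker_def R_lin)
    then have "cinner (u - v) u = 0" "cinner (u - v) v = 0"
      using that(1,2) by (auto simp: orth_compl_def)
    then have "cinner (u - v) (u - v) = 0"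
      by (simp only: cinner_diff_right[of "u - v" u v]) simp
    then show ?thesis by simp
  qed
  have add: "S (x + y) = S x + S y" for x y
    by (rule uniq) (use S in \<open>auto simp: orth_compl_def cinner_add_right R_lin RS B_lin\<close>)
  have scale: "S (c *\<^sub>C x) = c *\<^sub>C S x" for c x
    by (rule uniq) (use S in \<open>auto simp: orth_compl_def cinner_scaleC_right R_lin RS B_lin\<close>)
  \<comment> \<open>Tested against the range of R, S is expressed by the bounded operator B. This
    makes the sets F n closed, while |S y| bounds the index n at which y is covered.\<close>
  have form: "cinner (S y) (R x) = cinner (B y) x" for x y
    using selfadjoint_sym[OF R, of "S y" x] by (simp add: RS)
  define F where "F n = {y. \<forall>x. cmod (cinner (B y) x) \<le> real n * norm (R x)}" for n :: nat
  have "closed (F n)" for n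
  proof -
    have "F n = (\<Inter>x. {y. cmod (cinner (B y) x) \<le> real n * norm (R x)})"
      by (auto simp: F_def)
    also have "closed \<dots>"
      by (intro closed_INT ballI closed_Collect_le continuous_on_norm continuous_on_cinner
          continuous_on_bounded_clinear B continuous_on_const)
    finally show ?thesis .
  qed
  moreover have "\<Union>(range F) = UNIV"
  proof -
    have "y \<in> \<Union>(range F)" for y
    proof -
      obtain n where n: "norm (S y) \<le> real n"
        using real_arch_simple by blast
      have "cmod (cinner (B y) x) \<le> real n * norm (R x)" for x
        unfolding form[symmetric]
        by (rule order_trans[OF Cauchy_Schwarz mult_right_mono[OF n]]) simp
      then show ?thesis by (auto simp: F_def)
    qed
    then show ?thesis by blast
  qed
  ultimately obtain n where "interior (F n) \<noteq> {}"
    using Met_TC.metric_Baire_category_alt[of "range F"]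
    by (auto simp: complete_UNIV)
  then obtain y0 e where e: "0 < e" "cball y0 e \<subseteq> F n"
    by (meson all_not_in_conv mem_interior_cball)
  \<comment> \<open>A small y is a difference of two points of the ball inside \<open>F n\<close>,
    hence the factor 2.\<close>
  have small: "cmod (cinner (B y) x) \<le> 2 * real n * norm (R x)" if "norm y \<le> e" for x y
  proof -
    have "y0 + y \<in> F n" "y0 \<in> F n"
      using that e by (auto simp: subset_iff dist_norm)
    then have "cmod (cinner (B (y0 + y)) x) \<le> real n * norm (R x)" "cmod (cinner (B y0) x) \<le> real n * norm (R x)"
      by (simp_all add: F_def)
    moreover have "cinner (B y) x = cinner (B (y0 + y)) x - cinner (B y0) x"
      by (simp add: B_lin cinner_add_left)
    ultimately show ?thesis
      using norm_triangle_ineq4[of "cinner (B (y0 + y)) x" "cinner (B y0) x"] by simp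
  qed
  define C where "C = 2 * real n / e"
  have "0 \<le> C"
    using e(1) by (simp add: C_def)
  have bound: "cmod (cinner (S y) (R x)) \<le> C * norm y * norm (R x)" for x y
  proof (cases "y = 0")
    case False
    have "cmod (cinner (B ((e / norm y) *\<^sub>R y)) x) \<le> 2 * real n * norm (R x)"
      by (rule small) (use e(1) False in simp)
    then have "e / norm y * cmod (cinner (B y) x) \<le> 2 * real n * norm (R x)"
      using e(1) by (simp add: B_lin norm_mult norm_divide)
    then show ?thesis
      using e(1) False by (simp add: form C_def field_simps)
  qed (simp add: form B_lin)
  have "norm (S y) \<le> C * norm y" for y
  proof -
    \<comment> \<open>By density the bound for test vectors R x extends to the test vector S y
      itself.\<close>
    have "S y \<in> closure (range R)"
      using S orth_compl_op_ker_subset[OF R] by blast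
    then obtain u where u: "\<And>n. u n \<in> range R" "u \<longlonglongrightarrow> S y"
      by (auto simp: closure_sequential)
    have "cmod (cinner (S y) (u n)) \<le> C * norm y * norm (u n)" for n
      using u(1)[of n] bound by auto
    then have "cmod (cinner (S y) (S y)) \<le> C * norm y * norm (S y)"
      by (intro LIMSEQ_le[OF tendsto_norm[OF tendsto_cinner[OF tendsto_const u(2)]]
            tendsto_mult_left[OF tendsto_norm[OF u(2)]]]) auto
    then show ?thesis
      using \<open>0 \<le> C\<close> by (cases "S y = 0") (auto simp: cinner_self norm_power power2_eq_square norm_mult)
  qed
  then show ?thesis
    by (rule bounded_clinearI[OF add scale])
qed

section \<open>Blocks and Douglas' lemma\<close>

lemma block_apply:
  assumes "bounded_clinear A"
  shows "A (x, y) = (block11 A x + block12 A y, snd (A (x, 0)) + block22 A y)"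
proof -
  have "A (x, y) = A (x, 0) + A (0, y)"
    using bounded_clinear_simps(1)[OF assms, of "(x, 0)" "(0, y)"] by simp
  then show ?thesis
    by (simp add: block11_def block12_def block22_def prod_eq_iff)
qed

lemma selfadjoint_block11:
  assumes A: "selfadjoint A" shows "selfadjoint (block11 A)"
  unfolding selfadjoint_def
proof (intro conjI allI)
  show "bounded_clinear (block11 A)"
    unfolding block11_def
    by (intro bounded_clinear_compose[OF bounded_clinear_fst]
        bounded_clinear_compose[OF selfadjoint_bounded[OF A]] bounded_clinear_embeddings)
  show "cinner (block11 A x) y = cinner x (block11 A y)" for x y
    using selfadjoint_sym[OF A, of "(x, 0)" "(y, 0)"] by (simp add: cinner_prod_def block11_def)
qed

lemma selfadjoint_block22:
  assumes A: "selfadjoint A" shows "selfadjoint (block22 A)"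
  unfolding selfadjoint_def
proof (intro conjI allI)
  show "bounded_clinear (block22 A)"
    unfolding block22_def
    by (intro bounded_clinear_compose[OF bounded_clinear_snd]
        bounded_clinear_compose[OF selfadjoint_bounded[OF A]] bounded_clinear_embeddings)
  show "cinner (block22 A x) y = cinner x (block22 A y)" for x y
    using selfadjoint_sym[OF A, of "(0, x)" "(0, y)"] by (simp add: cinner_prod_def block22_def)
qed

lemma bounded_clinear_block12:
  "bounded_clinear A \<Longrightarrow> bounded_clinear (block12 A)"
  unfolding block12_def
  by (rule bounded_clinear_compose[OF bounded_clinear_fst])
    (rule bounded_clinear_compose[OF _ bounded_clinear_embeddings(2)])

lemma block_form:
  assumes A: "selfadjoint A"
  shows "Re (cinner (x, y) (A (x, y))) = Re (cinner x (block11 A x)) + 2 * Re (cinner x (block12 A y))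
    + Re (cinner y (block22 A y))"
proof -
  have "cinner y (snd (A (x, 0))) = cinner (block12 A y) x"
    using selfadjoint_sym[OF A, of "(0, y)" "(x, 0)"] by (simp add: cinner_prod_def block12_def)
  then show ?thesis
    using Re_cinner_commute[of "block12 A y" x]
    by (subst block_apply[OF selfadjoint_bounded[OF A]]) (simp add: cinner_prod_def cinner_add_right)
qed

text \<open>The form inequality of A for (x, 0) and (0, y) bounds |<a, x>| by C |R x|. So <a, x> is
  a bounded functional of R x, and its Riesz vector z satisfies R z = a.\<close>

lemma nonneg_op_imp_range_block12:
  fixes A :: "'a::chilbert_space \<times> 'b::chilbert_space \<Rightarrow> 'a \<times> 'b"
  assumes A: "nonneg_op A"
  shows "range (block12 A) \<subseteq> range (op_sqrt (op_abs (block11 A)))"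
proof
  note A_sa = nonneg_opD(1)[OF A]
  note A11_sa = selfadjoint_block11[OF A_sa]
  have A11: "nonneg_op (block11 A)"
    using A11_sa nonneg_opD(2)[OF A, of "(_, 0)"]
    by (simp add: nonneg_op_def cinner_prod_def block11_def)
  define R where "R = op_sqrt (op_abs (block11 A))"
  have abs: "op_abs (block11 A) = block11 A"
    unfolding op_abs_def by (rule op_sqrt_eqI[OF A11]) simp
  have R: "nonneg_op R" "\<And>x. R (R x) = block11 A x"
    unfolding R_def abs by (rule op_sqrt[OF A11])+
  note R_sa = nonneg_opD(1)[OF R(1)]
  note R_lin = bounded_clinear_simps[OF selfadjoint_bounded[OF R_sa]]
  have R_form: "Re (cinner x (block11 A x)) = (norm (R x))\<^sup>2" for x
    using arg_cong[OF selfadjoint_sym[OF R_sa, of x "R x"], of Re] by (simp add: R(2))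
  fix a assume "a \<in> range (block12 A)"
  then obtain y where y: "a = block12 A y" by blast
  define C where "C = sqrt (Re (cinner y (block22 A y)))"
  have a_le: "cmod (cinner a x) \<le> C * norm (R x)" for x
  proof -
    have "(cmod (cinner (x, 0) (A (0, y))))\<^sup>2 \<le> Re (cinner (x, 0) (A (x, 0))) * Re (cinner (0, y) (A (0, y)))"
      using A by (intro form_Cauchy_Schwarz) (auto simp: nonneg_op_def selfadjoint_def)
    moreover have "0 \<le> Re (cinner y (block22 A y))"
      using nonneg_opD(2)[OF A, of "(0, y)"] by (simp add: cinner_prod_def block22_def)
    ultimately have "(cmod (cinner x a))\<^sup>2 \<le> (norm (R x) * C)\<^sup>2"
      by (simp add: cinner_prod_def C_def power_mult_distrib R_form[symmetric] y block12_def block11_def block22_def)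
    then have "cmod (cinner x a) \<le> norm (R x) * C"
      by (rule power2_le_imp_le) (simp add: C_def \<open>0 \<le> Re _\<close>)
    then show ?thesis
      by (metis cinner_commute complex_mod_cnj mult.commute)
  qed
  \<comment> \<open>An arbitrary preimage is chosen; the bound shows that the value depends on v
    alone.\<close>
  define f where "f v = cinner a (SOME x. R x = v)" for v
  have f: "f (R x) = cinner a x" for x
  proof -
    have "R (SOME x'. R x' = R x) = R x"
      by (rule someI[of _ x]) simp
    then have "cmod (cinner a ((SOME x'. R x' = R x) - x)) \<le> C * 0"
      using a_le[of "(SOME x'. R x' = R x) - x"] by (simp add: R_lin)
    then show ?thesis
      by (simp add: f_def cinner_diff_right)
  qed
  obtain z where z: "\<And>v. v \<in> range R \<Longrightarrow> f v = cinner z v"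
  proof (rule Riesz_on_subspace[of "range R" f C])
    show "complex_vector.subspace (range R)"
      by (intro subspace_range selfadjoint_bounded R_sa)
    show "f (v + w) = f v + f w" if "v \<in> range R" "w \<in> range R" for v w
      using that by (auto simp: f cinner_add_right simp flip: R_lin(1))
    show "f (c *\<^sub>C v) = c * f v" if "v \<in> range R" for c v
      using that by (auto simp: f cinner_scaleC_right simp flip: R_lin(5))
    show "cmod (f v) \<le> C * norm v" if "v \<in> range R" for v
      using that a_le by (auto simp: f)
  qed blast
  have "a = R z"
  proof (rule cinner_eqI)
    fix x
    have "cinner a x = cinner (R z) x"
      using z[of "R x"] by (simp add: f selfadjoint_sym[OF R_sa])
    then show "cinner x a = cinner x (R z)"
      using cinner_commute[of x a] cinner_commute[of x "R z"] by simp
  qed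
  then show "a \<in> range (op_sqrt (op_abs (block11 A)))"
    by (simp add: R_def)
qed

section \<open>The Schur complement\<close>

lemma orth_projection_fixes_range: "orth_projection P \<Longrightarrow> x \<in> range P \<Longrightarrow> P x = x"
  using orth_projection_idem[of P] by (metis imageE)

text \<open>Both comparisons use injective maps and hold in \<open>enat\<close>, so the equality
  covers infinite dimensions, and the finiteness equivalence can be read off from it.\<close>

lemma nu_minus_block:
  fixes A :: "'a::chilbert_space \<times> 'b::chilbert_space \<Rightarrow> 'a \<times> 'b"
  assumes A: "selfadjoint A"
    and range: "range (block12 A) \<subseteq> range (op_sqrt (op_abs (block11 A)))"
  defines "J \<equiv> op_sign (block11 A)"
    and "S \<equiv> abs_inv_sqrt (block11 A) \<circ> block12 A"
  defines "T \<equiv> \<lambda>y. block22 A y - adj S (J (S y))"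
  shows "selfadjoint T" "nu_minus A = nu_minus (block11 A) + nu_minus T"
proof -
  define X where "X = block11 A"
  have X: "selfadjoint X"
    unfolding X_def by (rule selfadjoint_block11[OF A])
  obtain N where negX: "neg_projection X N" and nuX: "nu_minus X = ecdim (range N)"
    and sign: "op_sign X = (\<lambda>x. x - 2 *\<^sub>R N x)"
    by (rule nu_minus_eq[OF X])
  note N = neg_projectionD[OF X negX]
  note N_lin = bounded_clinear_simps[OF orth_projection_bounded[OF N(1)]]
  have J: "J x = x - 2 *\<^sub>R N x" for x
    by (simp add: J_def sign flip: X_def)
  have J_sa: "selfadjoint J"
    using N(1) unfolding J_def X_def[symmetric] sign
    by (intro selfadjoint_diff selfadjoint_scaleR selfadjoint_id) (simp add: orth_projection_def)
  note J_lin = bounded_clinear_simps[OF selfadjoint_bounded[OF J_sa]]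
  have JJ: "J (J x) = x" for x
    using scaleR_left_distrib[of 2 2 "N x"]
    by (simp add: J N_lin orth_projection_idem[OF N(1)] algebra_simps)
  define R where "R = op_sqrt (op_abs X)"
  note R = abs_root[OF X negX, folded R_def]
  note R_sa = nonneg_opD(1)[OF R(1)]
  note R_lin = bounded_clinear_simps[OF selfadjoint_bounded[OF R_sa]]
  have RJR: "R (J (R x)) = X x" for x
    using scaleR_left_distrib[of 2 2 "N (X x)"]
    by (simp add: J R_lin R(3) R(2) N(2) N_lin orth_projection_idem[OF N(1)] algebra_simps flip: N(2))
  define B where "B = block12 A"
  have B: "bounded_clinear B"
    unfolding B_def by (rule bounded_clinear_block12[OF selfadjoint_bounded[OF A]])
  have ker_R: "op_ker R = op_ker X"
    by (simp add: op_ker_def R(4))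
  have B_range: "B y \<in> range (op_sqrt (op_abs X))" for y
    using range by (auto simp: X_def B_def)
  have S_perp: "S y \<in> orth_compl (op_ker R)" and RS: "R (S y) = B y" for y
    using abs_inv_sqrt[OF X B_range] unfolding ker_R by (simp_all add: S_def R_def X_def B_def)
  have S: "bounded_clinear S"
    by (rule bounded_clinear_factor[OF R_sa B RS S_perp])
  note adj_S = bounded_clinear_adj[OF S]
  note adj_lin = bounded_clinear_simps[OF adj_S]
  have SJS: "bounded_clinear (\<lambda>y. adj S (J (S y)))"
    by (intro bounded_clinear_compose[OF adj_S] bounded_clinear_compose[OF selfadjoint_bounded[OF J_sa]] S)
  have "selfadjoint (\<lambda>y. adj S (J (S y)))"
    using SJS by (simp add: selfadjoint_def cinner_adj'[OF S] cinner_adj[OF S, symmetric] selfadjoint_sym[OF J_sa])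
  then show T: "selfadjoint T"
    unfolding T_def by (intro selfadjoint_diff selfadjoint_block22 A)
  define form where "form q = Re (cinner (fst q) (J (fst q))) + Re (cinner (snd q) (T (snd q)))" for q
  \<comment> \<open>Completion of the square: by J^2 = 1 the J-form of R x + J S y consists of the
    form of A11, the cross terms with A12 = R S, and the form of S under J, which T subtracts
    again.\<close>
  define D where "D p = (R (fst p) + J (S (snd p)), snd p)" for p
  have D: "bounded_clinear D"
    unfolding D_def
    by (intro bounded_clinear_Pair bounded_clinear_add bounded_clinear_snd
        bounded_clinear_compose[OF selfadjoint_bounded[OF R_sa] bounded_clinear_fst]
        bounded_clinear_compose[OF selfadjoint_bounded[OF J_sa]]
        bounded_clinear_compose[OF S bounded_clinear_snd])
  have form_A: "Re (cinner p (A p)) = form (D p)" for p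
  proof -
    obtain x y where p: "p = (x, y)" by force
    define w where "w = R x + J (S y)"
    have 1: "cinner (R x) (J (R x)) = cinner x (X x)"
      by (simp add: selfadjoint_sym[OF R_sa] RJR)
    have 2: "cinner (R x) (S y) = cinner x (B y)"
      by (simp add: selfadjoint_sym[OF R_sa] RS)
    have 3: "cinner (J (S y)) (J (R x)) = cinner (B y) x"
      using selfadjoint_sym[OF R_sa, of "S y" x] by (simp add: selfadjoint_sym[OF J_sa] JJ RS)
    have 4: "cinner (J (S y)) (S y) = cinner y (adj S (J (S y)))"
      by (simp add: cinner_adj[OF S, symmetric] selfadjoint_sym[OF J_sa])
    have "cinner w (J w) = cinner x (X x) + cinner x (B y) + cinner (B y) x + cinner y (adj S (J (S y)))"
      by (simp add: w_def J_lin JJ cinner_simps 1 2 3 4)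
    then have "form (D p) = Re (cinner x (X x)) + 2 * Re (cinner x (B y)) + Re (cinner y (block22 A y))"
      using Re_cinner_commute[of "B y" x]
      by (simp add: form_def D_def p flip: w_def) (simp add: T_def cinner_diff_right)
    then show ?thesis
      by (simp add: p block_form[OF A] X_def B_def)
  qed

  obtain NT where negT: "neg_projection T NT" and nuT: "nu_minus T = ecdim (range NT)"
    by (rule nu_minus_eq[OF T])
  note NT = neg_projectionD[OF T negT]
  obtain NA where negA: "neg_projection A NA" and nuA: "nu_minus A = ecdim (range NA)"
    by (rule nu_minus_eq[OF A])
  note NA = neg_projectionD[OF A negA]
  note NA_lin = bounded_clinear_simps[OF orth_projection_bounded[OF NA(1)]]
  have J_form: "Re (cinner x (J x)) = (norm x)\<^sup>2 - 2 * (norm (N x))\<^sup>2" for x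
    by (simp add: J cinner_diff_right cinner_orth_projection[OF N(1)])
  have "nu_minus A \<le> ecdim (range N \<times> range NT)"
    unfolding nuA
  proof (rule ecdim_le_if_injective)
    show "bounded_clinear (\<lambda>p. (N (fst (D p)), NT (snd (D p))))"
      by (intro bounded_clinear_Pair bounded_clinear_compose[OF orth_projection_bounded[OF N(1)]]
          bounded_clinear_compose[OF orth_projection_bounded[OF NT(1)]]
          bounded_clinear_compose[OF bounded_clinear_fst D] bounded_clinear_compose[OF bounded_clinear_snd D])
    show "complex_vector.subspace (range NA)"
      by (intro subspace_range orth_projection_bounded NA(1))
    show "(\<lambda>p. (N (fst (D p)), NT (snd (D p)))) ` range NA \<subseteq> range N \<times> range NT"
      by blast
    fix p assume "p \<in> range NA" and z: "(N (fst (D p)), NT (snd (D p))) = 0"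
    have p: "NA p = p"
      by (rule orth_projection_fixes_range[OF NA(1) \<open>p \<in> range NA\<close>])
    have "N (fst (D p)) = 0" "NT (snd (D p)) = 0"
      using z by (simp_all add: zero_prod_def)
    \<comment> \<open>Where N and NT vanish both summands are nonnegative, whereas A is negative on
      nonzero vectors of the range of NA.\<close>
    then have "0 \<le> form (D p)"
      using NT(3) by (simp add: form_def J_form)
    then show "p = 0"
      using NA(4)[OF p] form_A[of p] by fastforce
  qed
  moreover have "ecdim (range N \<times> range NT) \<le> nu_minus A"
    unfolding nuA
  proof -
    \<comment> \<open>The closure makes the orthogonal projection available; nonnegativity of the
      form survives by continuity.\<close>
    define Z where "Z = closure (D ` {p. NA p = 0})"
    have "complex_vector.subspace {p. NA p = 0}"
      using subspace_op_ker[OF orth_projection_bounded[OF NA(1)]] by (simp add: op_ker_def)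
    then have "complex_vector.subspace Z"
      unfolding Z_def by (intro subspace_closure bounded_clinear_subspace_image D)
    then obtain P where P: "orth_projection P" "range P = Z"
      by (rule orth_projection_onto) (simp add: Z_def)
    note P_lin = bounded_clinear_simps[OF orth_projection_bounded[OF P(1)]]
    have adj_D: "adj D q = (R (fst q), adj S (J (fst q)) + snd q)" for q
    proof (rule cinner_eqI)
      fix p
      show "cinner p (adj D q) = cinner p (R (fst q), adj S (J (fst q)) + snd q)"
        by (simp add: cinner_adj[OF D, symmetric])
          (simp add: cinner_prod_def D_def cinner_simps cinner_adj[OF S, symmetric]
            selfadjoint_sym[OF R_sa] selfadjoint_sym[OF J_sa])
    qed
    have Z_form: "0 \<le> form q" if "q \<in> Z" for q
    proof -
      have "closed {q. 0 \<le> form q}"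
        unfolding form_def
        by (intro closed_Collect_le continuous_on_const continuous_on_add continuous_on_Re
            continuous_on_cinner continuous_on_fst continuous_on_snd continuous_on_id
            continuous_on_compose2[OF continuous_on_bounded_clinear[of J UNIV]]
            continuous_on_compose2[OF continuous_on_bounded_clinear[of T UNIV]]
            selfadjoint_bounded J_sa T) auto
      moreover have "D ` {p. NA p = 0} \<subseteq> {q. 0 \<le> form q}"
        using NA(3) by (auto simp flip: form_A)
      ultimately show ?thesis
        using that closure_minimal unfolding Z_def by blast
    qed
    \<comment> \<open>N preserves ker X = ker R, yet X is negative on nonzero vectors of its range.
      So J acts as the identity on this kernel.\<close>
    have N_ker: "N k = 0" if "R k = 0" for k
    proof (rule ccontr)
      assume "N k \<noteq> 0"
      then have "Re (cinner (N k) (X (N k))) < 0"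
        by (intro N(4)) (simp_all add: orth_projection_idem[OF N(1)])
      moreover have "X (N k) = 0"
        using that by (simp add: R(4) N_lin flip: N(2))
      ultimately show False by simp
    qed
    have Z_perp: "fst q \<in> orth_compl (op_ker R)" if "q \<in> Z" for q
    proof -
      have "closed (orth_compl (op_ker R) \<times> (UNIV :: 'b set))"
        by (intro closed_Times closed_orth_compl closed_UNIV)
      moreover have "D ` {p. NA p = 0} \<subseteq> orth_compl (op_ker R) \<times> UNIV"
      proof -
        have "cinner k (R x + J (S y)) = 0" if k: "R k = 0" for k x y
        proof -
          have "cinner k (R x) = 0"
            using k by (simp flip: selfadjoint_sym[OF R_sa])
          moreover have "cinner k (J (S y)) = cinner k (S y)"
            using selfadjoint_sym[OF J_sa, of k "S y"] by (simp add: J N_ker[OF k])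
          moreover have "cinner k (S y) = 0"
            using S_perp[of y] k by (simp add: orth_compl_def op_ker_def)
          ultimately show ?thesis by (simp add: cinner_add_right)
        qed
        then show ?thesis by (auto simp: D_def orth_compl_def op_ker_def)
      qed
      ultimately have "Z \<subseteq> orth_compl (op_ker R) \<times> UNIV"
        unfolding Z_def by (intro closure_minimal)
      with that show ?thesis by auto
    qed
    show "ecdim (range N \<times> range NT) \<le> ecdim (range NA)"
    proof (rule ecdim_le_if_injective)
      show "bounded_clinear (\<lambda>w. adj D (w - P w))"
        by (intro bounded_clinear_compose[OF bounded_clinear_adj[OF D]] bounded_clinear_diff
            bounded_clinear_id orth_projection_bounded P(1))
      show "complex_vector.subspace (range N \<times> range NT)"
        by (intro subspace_Times subspace_range orth_projection_bounded N(1) NT(1))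
      show "(\<lambda>w. adj D (w - P w)) ` (range N \<times> range NT) \<subseteq> range NA"
      proof (rule image_subsetI)
        fix w
        define g where "g = adj D (w - P w)"
        \<comment> \<open>D p lies in Z, to which w - P w is orthogonal, so p is orthogonal to g. As
          p is the component of g in the kernel of NA, it vanishes.\<close>
        define p where "p = g - NA g"
        have NAp: "NA p = 0"
          by (simp add: p_def NA_lin orth_projection_idem[OF NA(1)])
        then have "D p \<in> range P"
          unfolding P(2) Z_def by (intro subsetD[OF closure_subset] imageI) simp
        then have "P (D p) = D p"
          by (rule orth_projection_fixes_range[OF P(1)])
        then have "cinner (D p) (w - P w) = cinner (D p) (P (w - P w))"
          by (metis orth_projection_sym[OF P(1)])
        then have "cinner p g = 0"
          by (simp add: g_def cinner_adj[OF D, symmetric] P_lin orth_projection_idem[OF P(1)])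
        moreover have "cinner p (NA g) = 0"
          using NAp by (simp flip: orth_projection_sym[OF NA(1)])
        ultimately have "cinner p p = 0"
          by (subst (2) p_def) (simp add: cinner_diff_right)
        then have "g = NA g" by (simp add: p_def)
        then show "adj D (w - P w) \<in> range NA"
          unfolding g_def by blast
      qed
      fix w assume "w \<in> range N \<times> range NT" and z: "adj D (w - P w) = 0"
      then have w: "N (fst w) = fst w" "NT (snd w) = snd w"
        by (auto intro: orth_projection_fixes_range N(1) NT(1))
      define k h where "k = fst (w - P w)" and "h = snd (w - P w)"
      have k: "R k = 0" and h: "adj S (J k) + h = 0"
        using z by (simp_all add: adj_D k_def h_def zero_prod_def)
      \<comment> \<open>k is orthogonal to fst w, because N k = 0, and to the first component of P
        w, by \<open>Z_perp\<close>; so it is orthogonal to their difference, which is k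
        itself.\<close>
      have "cinner k (fst w) = cinner (N k) (fst w)"
        by (metis w(1) orth_projection_sym[OF N(1)])
      then have "cinner k (fst w) = 0"
        by (simp add: N_ker[OF k])
      moreover have "cinner k (fst (P w)) = 0"
        using Z_perp[of "P w"] P(2) k by (auto simp: orth_compl_def op_ker_def)
      ultimately have "cinner k k = 0"
        by (subst (2) k_def) (simp add: cinner_diff_right)
      then have "k = 0" by simp
      moreover have "h = 0"
        using h \<open>k = 0\<close> by (simp add: J_lin adj_lin)
      ultimately have "w = P w"
        by (simp add: k_def h_def prod_eq_iff)
      \<comment> \<open>Now w lies in Z, where the form is nonnegative, and in the product of the
        two negative ranges, where it is negative unless w = 0.\<close>
      then have "0 \<le> form w"
        using Z_form[of w] P(2) by (metis rangeI)
      moreover have "Re (cinner (fst w) (J (fst w))) = - (norm (fst w))\<^sup>2"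
        by (simp add: J_form w(1))
      moreover have "Re (cinner (snd w) (T (snd w))) \<le> 0"
        using NT(4)[OF w(2)] by (cases "snd w = 0") auto
      ultimately have "(norm (fst w))\<^sup>2 \<le> 0"
        unfolding form_def by linarith
      then have "fst w = 0" by simp
      moreover have "snd w = 0"
        using NT(4)[OF w(2)] \<open>0 \<le> form w\<close> \<open>fst w = 0\<close> by (force simp: form_def J_lin)
      ultimately show "w = 0"
        by (simp add: prod_eq_iff)
    qed
  qed
  ultimately show "nu_minus A = nu_minus (block11 A) + nu_minus T"
    using ecdim_Times[of "range N" "range NT"] N(1) NT(1)
    by (simp add: subspace_range orth_projection_bounded nuT nuX flip: X_def)
qed

theorem proposition3p5:
  fixes A :: "'a::chilbert_space \<times> 'b::chilbert_space \<Rightarrow> 'a \<times> 'b"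
    and A11 J :: "'a \<Rightarrow> 'a"
    and A12 S :: "'b \<Rightarrow> 'a"
    and A22 T :: "'b \<Rightarrow> 'b"
  assumes "selfadjoint A"
    and "A11 = block11 A" and "A12 = block12 A" and "A22 = block22 A"
    and "J = op_sign A11"
    and "S = abs_inv_sqrt A11 \<circ> A12"
    and "T = (\<lambda>y. A22 y - adj S (J (S y)))"
  shows "(range A12 \<subseteq> range (op_sqrt (op_abs A11)) \<longrightarrow>
            (nu_minus A < \<infinity> \<longleftrightarrow> nu_minus A11 < \<infinity> \<and> nu_minus T < \<infinity>) \<and>
            (nu_minus A < \<infinity> \<longrightarrow> nu_minus A = nu_minus A11 + nu_minus T)) \<and>
         (nonneg_op A \<longleftrightarrow>
            range A12 \<subseteq> range (op_sqrt (op_abs A11)) \<and> nonneg_op A11 \<and> nonneg_op T)"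
proof (cases "range A12 \<subseteq> range (op_sqrt (op_abs A11))")
  case True
  have T: "selfadjoint T" and eq: "nu_minus A = nu_minus A11 + nu_minus T"
    using nu_minus_block[OF assms(1) True[unfolded assms(2,3)]] unfolding assms(2-7) by auto
  have A11: "selfadjoint A11"
    unfolding assms(2) by (rule selfadjoint_block11[OF assms(1)])
  have "nu_minus A < \<infinity> \<longleftrightarrow> nu_minus A11 < \<infinity> \<and> nu_minus T < \<infinity>"
    unfolding eq by (simp add: plus_eq_infty_iff_enat)
  \<comment> \<open>Nonnegativity means negative index 0, and a sum in \<open>enat\<close> is 0
    exactly when both terms are.\<close>
  moreover have "nonneg_op A \<longleftrightarrow> nonneg_op A11 \<and> nonneg_op T"
    using eq by (simp add: assms(1) A11 T flip: nu_minus_eq_0_iff)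
  ultimately show ?thesis
    using True eq by blast
next
  \<comment> \<open>Without the inclusion both sides of the last equivalence are false, the left one
    by Douglas' lemma.\<close>
  case False
  then show ?thesis
    using nonneg_op_imp_range_block12[of A] unfolding assms(2,3) by blast
qed

end
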